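(* Fix $\widetilde\vartheta,\vartheta\in\mathcal M$ with non-zero $\vartheta_{11},\vartheta_{12},\vartheta_{22}$. Then an eigenvalue $\lambda\in\rho(\mathbf L_\infty)$ of $\widetilde{\mathbf L}(\widetilde\vartheta+t\vartheta)$ ($t\in\mathbb R$) has multiplicity $2$ only if $$t=\frac{-\widetilde\vartheta_{11}u_1^{[1]}+u_2^{[1]}}{\vartheta_{11}u_1^{[1]}}=\frac{-\widetilde\vartheta_{12}u_1^{[1]}+1}{\vartheta_{12}u_1^{[1]}}=\frac{-\widetilde\vartheta_{21}u_1^{[1]}+1}{\vartheta_{21}u_1^{[1]}}=\frac{-\widetilde\vartheta_{22}u_1^{[1]}+u_1^{[0]}}{\vartheta_{22}u_1^{[1]}},$$ where $u_i^{[j]}=u_i^{[j]}(b,\lambda)$. In particular, the operator $\widetilde{\mathbf L}(\widetilde\vartheta+t\vartheta)$ has $\lambda\in\rho(\mathbf L_\infty)$ as an eigenvalue with multiplicity two at most for one value of $t$.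
   Context: Setting. Let $-\infty\le a<b\le\infty$, let $p,w>0$ a.e. and $q$ real-valued a.e. on $(a,b)$ with $1/p,q,w\in L^1_{\rm loc}((a,b),dx)$, and put $\ell[f]=-\frac1w\big((pf')'+qf\big)$, acting in $L^2[(a,b),w]$ with $\langle f,g\rangle=\int_a^b f\overline g\,w\,dx$. Let $\mathcal D_{\max}=\{f: f,pf'\in AC_{\rm loc}(a,b),\ f,\ell[f]\in L^2[(a,b),w]\}$ and $[f,g](x)=p(x)\big(f(x)\overline{g'(x)}-f'(x)\overline{g(x)}\big)$; for $f,g\in\mathcal D_{\max}$ the limits at the endpoints exist. Let $\mathcal D_{\min}=\{f\in\mathcal D_{\max}:[f,g](b)-[f,g](a)=0\ \forall g\in\mathcal D_{\max}\}$, and let $\mathbf L_{\max},\mathbf L_{\min}$ be $\ell$ with domains $\mathcal D_{\max},\mathcal D_{\min}$. Standing assumptions: both endpoints are limit-circle, and $\mathbf L_{\min}$ is semi-bounded from below with lower bound $K\in\mathbb R$ (so the endpoints are non-oscillating). Quasi-derivatives. Fix $\lambda_0\in\mathbb R$. A real solution $u$ of $(\ell-\lambda_0)y=0$ is principal (non-principal) at an endpoint if $1/(pu^2)$ is not integrable (is integrable) there. Let $u_a,v_a$ (resp. $u_b,v_b$) be real principal and non-principal solutions of $(\ell-\lambda_0)y=0$ at $a$ (resp. $b$) with $[u_a,v_a](a)=1$, $[u_b,v_b](b)=1$. For $f\in\mathcal D_{\max}$: $f^{[0]}(a)=[f,v_a](a)$, $f^{[1]}(a)=-[f,u_a](a)$,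 $f^{[0]}(b)=[f,v_b](b)$, $f^{[1]}(b)=-[f,u_b](b)$. For $\lambda\in\mathbb C$ let $u_1(\cdot,\lambda),u_2(\cdot,\lambda)$ be the solutions of $(\ell-\lambda)y=0$ with $u_1^{[0]}(a,\lambda)=1,\ u_1^{[1]}(a,\lambda)=0,\ u_2^{[0]}(a,\lambda)=0,\ u_2^{[1]}(a,\lambda)=1$; they satisfy $u_1^{[0]}(b,\lambda)u_2^{[1]}(b,\lambda)-u_1^{[1]}(b,\lambda)u_2^{[0]}(b,\lambda)=1$. Extensions. $\Gamma_0'f=(-f^{[1]}(a),f^{[1]}(b))^T$, $\Gamma_1'f=(f^{[0]}(a),f^{[0]}(b))^T$. $\mathbf L_\infty$ is the restriction of $\mathbf L_{\max}$ to $\{f\in\mathcal D_{\max}: f^{[1]}(a)=f^{[1]}(b)=0\}$ and $\rho(\mathbf L_\infty)$ its resolvent set (on which $u_1^{[1]}(b,\lambda)\neq0$). $\mathcal M$ is the set of Hermitian $2\times2$ matrices; for $\vartheta\in\mathcal M$, $\widetilde{\mathbf L}(\vartheta)$ is the self-adjoint restriction of $\mathbf L_{\max}$ to $\{f\in\mathcal D_{\max}:\vartheta\Gamma_0'f=\Gamma_1'f\}$. *)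

theory Defs
  imports "HOL-Analysis.Analysis" "HOL-Library.Function_Algebras"
begin

section \<open>The differential expression\<close>

record sl_coeffs =
  lend :: ereal
  rend :: ereal
  cp :: "real \<Rightarrow> real"
  cq :: "real \<Rightarrow> real"
  cw :: "real \<Rightarrow> real"

datatype endpoint = LeftEnd | RightEnd

definition ivl :: "sl_coeffs \<Rightarrow> real set" where
  "ivl S = einterval (lend S) (rend S)"

definition locally_L1 :: "sl_coeffs \<Rightarrow> (real \<Rightarrow> real) \<Rightarrow> bool" where
  "locally_L1 S h \<longleftrightarrow> (\<forall>c d. {c..d} \<subseteq> ivl S \<longrightarrow> set_integrable lebesgue {c..d} h)"

definition admissible :: "sl_coeffs \<Rightarrow> bool" where
  "admissible S \<longleftrightarrow> lend S < rend S \<and>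
     (AE x in lebesgue_on (ivl S). cp S x > 0 \<and> cw S x > 0) \<and>
     locally_L1 S (\<lambda>x. 1 / cp S x) \<and> locally_L1 S (cq S) \<and> locally_L1 S (cw S)"

text \<open>Absolute continuity on a compact interval. A division is a finite family of
  non-overlapping compact intervals.\<close>

definition abs_cont_on :: "real \<Rightarrow> real \<Rightarrow> (real \<Rightarrow> complex) \<Rightarrow> bool" where
  "abs_cont_on c d f \<longleftrightarrow>
     (\<forall>\<epsilon>>0. \<exists>\<delta>>0. \<forall>D T. D division_of T \<and> T \<subseteq> {c..d} \<and> (\<Sum>k\<in>D. measure lborel k) < \<delta> \<longrightarrow>
        (\<Sum>k\<in>D. norm (f (Sup k) - f (Inf k))) < \<epsilon>)"

text \<open>A function on the interval \<^term>\<open>ivl S\<close> is represented by its extension by zero to the whole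
  line. Continuous functions that agree almost everywhere on the interval are therefore equal, so
  that domains of operators can be treated as sets of functions rather than of
  equivalence classes.\<close>

definition AC_loc :: "sl_coeffs \<Rightarrow> (real \<Rightarrow> complex) set" where
  "AC_loc S = {f. (\<forall>x. x \<notin> ivl S \<longrightarrow> f x = 0) \<and>
                  (\<forall>c d. {c..d} \<subseteq> ivl S \<longrightarrow> abs_cont_on c d f)}"

text \<open>\<^term>\<open>is_pdiff S f g\<close> says that \<open>g\<close> is the locally absolutely continuous representative of
  \<open>p f'\<close>; pointwise, \<open>p f'\<close> itself is only meaningful almost everywhere. That \<open>f\<close> and \<open>g\<close> are
  differentiable almost everywhere is automatic for locally absolutely continuous functions
  (Lebesgue's theorem); it is spelled out because the library does not provide that theorem.\<close>

definition is_pdiff :: "sl_coeffs \<Rightarrow> (real \<Rightarrow> complex) \<Rightarrow> (real \<Rightarrow> complex) \<Rightarrow> bool" where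
  "is_pdiff S f g \<longleftrightarrow> g \<in> AC_loc S \<and>
     (AE x in lebesgue_on (ivl S).
        f differentiable (at x) \<and> g x = cp S x *\<^sub>R vector_derivative f (at x)) \<and>
     (AE x in lebesgue_on (ivl S). g differentiable (at x))"

definition pdiff :: "sl_coeffs \<Rightarrow> (real \<Rightarrow> complex) \<Rightarrow> (real \<Rightarrow> complex)" where
  "pdiff S f = (THE g. is_pdiff S f g)"

definition AC2_loc :: "sl_coeffs \<Rightarrow> (real \<Rightarrow> complex) set" where
  "AC2_loc S = {f \<in> AC_loc S. \<exists>g. is_pdiff S f g}"

definition ell :: "sl_coeffs \<Rightarrow> (real \<Rightarrow> complex) \<Rightarrow> (real \<Rightarrow> complex)" where
  "ell S f = (\<lambda>x. - (1 / cw S x) *\<^sub>R (vector_derivative (pdiff S f) (at x) + cq S x *\<^sub>R f x))"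

definition solution :: "sl_coeffs \<Rightarrow> complex \<Rightarrow> (real \<Rightarrow> complex) \<Rightarrow> bool" where
  "solution S l y \<longleftrightarrow> y \<in> AC2_loc S \<and> (AE x in lebesgue_on (ivl S). ell S y x = l * y x)"


section \<open>Hilbert space and operators\<close>

definition L2w :: "sl_coeffs \<Rightarrow> (real \<Rightarrow> complex) set" where
  "L2w S = {f \<in> borel_measurable (lebesgue_on (ivl S)).
              integrable (lebesgue_on (ivl S)) (\<lambda>x. (cmod (f x))\<^sup>2 * cw S x)}"

definition ip :: "sl_coeffs \<Rightarrow> (real \<Rightarrow> complex) \<Rightarrow> (real \<Rightarrow> complex) \<Rightarrow> complex" where
  "ip S f g = (LINT x|lebesgue_on (ivl S). f x * cnj (g x) * complex_of_real (cw S x))"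

definition L2norm :: "sl_coeffs \<Rightarrow> (real \<Rightarrow> complex) \<Rightarrow> real" where
  "L2norm S f = sqrt (Re (ip S f f))"

definition Dmax :: "sl_coeffs \<Rightarrow> (real \<Rightarrow> complex) set" where
  "Dmax S = {f \<in> AC2_loc S. f \<in> L2w S \<and> ell S f \<in> L2w S}"

definition bracket :: "sl_coeffs \<Rightarrow> (real \<Rightarrow> complex) \<Rightarrow> (real \<Rightarrow> complex) \<Rightarrow> real \<Rightarrow> complex" where
  "bracket S f g x = f x * cnj (pdiff S g x) - pdiff S f x * cnj (g x)"

fun end_lim :: "sl_coeffs \<Rightarrow> endpoint \<Rightarrow> (real \<Rightarrow> complex) \<Rightarrow> complex" where
  "end_lim S LeftEnd h = Lim (at_right (lend S)) (h \<circ> real_of_ereal)"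
| "end_lim S RightEnd h = Lim (at_left (rend S)) (h \<circ> real_of_ereal)"

definition bracket_at ::
    "sl_coeffs \<Rightarrow> endpoint \<Rightarrow> (real \<Rightarrow> complex) \<Rightarrow> (real \<Rightarrow> complex) \<Rightarrow> complex" where
  "bracket_at S e f g = end_lim S e (bracket S f g)"

definition Dmin :: "sl_coeffs \<Rightarrow> (real \<Rightarrow> complex) set" where
  "Dmin S = {f \<in> Dmax S. \<forall>g\<in>Dmax S. bracket_at S RightEnd f g - bracket_at S LeftEnd f g = 0}"

text \<open>An operator is given by its domain (a set of functions continuous on \<^term>\<open>ivl S\<close> and zero
  outside) and its action.\<close>

type_synonym sl_op = "(real \<Rightarrow> complex) set \<times> ((real \<Rightarrow> complex) \<Rightarrow> (real \<Rightarrow> complex))"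

definition Lmax :: "sl_coeffs \<Rightarrow> sl_op" where
  "Lmax S = (Dmax S, ell S)"

definition restrict_op :: "sl_op \<Rightarrow> (real \<Rightarrow> complex) set \<Rightarrow> sl_op" where
  "restrict_op T D = (D \<inter> fst T, snd T)"

definition Lmin :: "sl_coeffs \<Rightarrow> sl_op" where
  "Lmin S = restrict_op (Lmax S) (Dmin S)"

definition bounded_below_by :: "sl_coeffs \<Rightarrow> sl_op \<Rightarrow> real \<Rightarrow> bool" where
  "bounded_below_by S T K \<longleftrightarrow> (\<forall>f\<in>fst T. Re (ip S (snd T f) f) \<ge> K * Re (ip S f f))"

text \<open>The resolvent set: \<open>T - l\<close> is a bijection from the domain of \<open>T\<close> onto the Hilbert space
  (whose elements are identified when they agree almost everywhere) with bounded inverse.\<close>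

definition resolvent_set :: "sl_coeffs \<Rightarrow> sl_op \<Rightarrow> complex set" where
  "resolvent_set S T = {l.
     (\<forall>g\<in>L2w S. \<exists>!f. f \<in> fst T \<and> (AE x in lebesgue_on (ivl S). snd T f x - l * f x = g x)) \<and>
     (\<exists>C. \<forall>f\<in>fst T. L2norm S f \<le> C * L2norm S (\<lambda>x. snd T f x - l * f x))}"

definition eigenspace :: "sl_coeffs \<Rightarrow> sl_op \<Rightarrow> complex \<Rightarrow> (real \<Rightarrow> complex) set" where
  "eigenspace S T l = {f \<in> fst T. AE x in lebesgue_on (ivl S). snd T f x = l * f x}"

global_interpretation cfun: vector_space "\<lambda>(c::complex) (f::real \<Rightarrow> complex) x. c * f x"
  defines cfun_dim = cfun.dim
  by unfold_locales (auto simp: fun_eq_iff algebra_simps)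

text \<open>In an infinite-dimensional space \<^const>\<open>cfun_dim\<close> is \<open>0\<close>; the value \<open>2\<close>
  used below really means a two-dimensional complex space.\<close>

definition ev_multiplicity :: "sl_coeffs \<Rightarrow> sl_op \<Rightarrow> complex \<Rightarrow> nat" where
  "ev_multiplicity S T l = cfun_dim (eigenspace S T l)"

definition eigenvalue :: "sl_coeffs \<Rightarrow> sl_op \<Rightarrow> complex \<Rightarrow> bool" where
  "eigenvalue S T l \<longleftrightarrow> (\<exists>f\<in>eigenspace S T l. f \<noteq> (\<lambda>x. 0))"


section \<open>Endpoints and quasi-derivatives\<close>

fun near :: "sl_coeffs \<Rightarrow> endpoint \<Rightarrow> real \<Rightarrow> real set" where
  "near S LeftEnd c = einterval (lend S) (ereal c)"
| "near S RightEnd c = einterval (ereal c) (rend S)"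

definition integrable_near :: "sl_coeffs \<Rightarrow> endpoint \<Rightarrow> (real \<Rightarrow> real) \<Rightarrow> bool" where
  "integrable_near S e h \<longleftrightarrow> (\<exists>c\<in>ivl S. set_integrable lebesgue (near S e c) h)"

definition limit_circle :: "sl_coeffs \<Rightarrow> endpoint \<Rightarrow> bool" where
  "limit_circle S e \<longleftrightarrow>
     (\<forall>l y. solution S l y \<longrightarrow> integrable_near S e (\<lambda>x. (cmod (y x))\<^sup>2 * cw S x))"

abbreviation cplx :: "(real \<Rightarrow> real) \<Rightarrow> (real \<Rightarrow> complex)" where
  "cplx u \<equiv> (\<lambda>x. complex_of_real (u x))"

text \<open>The trivial solution is excluded explicitly, since \<open>1 / 0 = 0\<close> would make it non-principal.\<close>

definition principal :: "sl_coeffs \<Rightarrow> real \<Rightarrow> endpoint \<Rightarrow> (real \<Rightarrow> real) \<Rightarrow> bool" where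
  "principal S l0 e u \<longleftrightarrow> solution S (of_real l0) (cplx u) \<and> u \<noteq> (\<lambda>x. 0) \<and>
     \<not> integrable_near S e (\<lambda>x. 1 / (cp S x * (u x)\<^sup>2))"

definition nonprincipal :: "sl_coeffs \<Rightarrow> real \<Rightarrow> endpoint \<Rightarrow> (real \<Rightarrow> real) \<Rightarrow> bool" where
  "nonprincipal S l0 e v \<longleftrightarrow> solution S (of_real l0) (cplx v) \<and> v \<noteq> (\<lambda>x. 0) \<and>
     integrable_near S e (\<lambda>x. 1 / (cp S x * (v x)\<^sup>2))"

text \<open>The families \<open>u\<close>, \<open>v\<close> collect the reference solutions \<open>u\<^sub>a, u\<^sub>b\<close> and \<open>v\<^sub>a, v\<^sub>b\<close>.\<close>

definition reference_system ::
    "sl_coeffs \<Rightarrow> real \<Rightarrow> (endpoint \<Rightarrow> real \<Rightarrow> real) \<Rightarrow> (endpoint \<Rightarrow> real \<Rightarrow> real) \<Rightarrow> bool" where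
  "reference_system S l0 u v \<longleftrightarrow>
     (\<forall>e. principal S l0 e (u e) \<and> nonprincipal S l0 e (v e) \<and>
          bracket_at S e (cplx (u e)) (cplx (v e)) = 1)"

definition quasi0 ::
    "sl_coeffs \<Rightarrow> (endpoint \<Rightarrow> real \<Rightarrow> real) \<Rightarrow> (real \<Rightarrow> complex) \<Rightarrow> endpoint \<Rightarrow> complex" where
  "quasi0 S v f e = bracket_at S e f (cplx (v e))"

definition quasi1 ::
    "sl_coeffs \<Rightarrow> (endpoint \<Rightarrow> real \<Rightarrow> real) \<Rightarrow> (real \<Rightarrow> complex) \<Rightarrow> endpoint \<Rightarrow> complex" where
  "quasi1 S u f e = - bracket_at S e f (cplx (u e))"


section \<open>Self-adjoint extensions\<close>

definition Gamma0 ::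
    "sl_coeffs \<Rightarrow> (endpoint \<Rightarrow> real \<Rightarrow> real) \<Rightarrow> (real \<Rightarrow> complex) \<Rightarrow> complex ^ 2" where
  "Gamma0 S u f = vector [- quasi1 S u f LeftEnd, quasi1 S u f RightEnd]"

definition Gamma1 ::
    "sl_coeffs \<Rightarrow> (endpoint \<Rightarrow> real \<Rightarrow> real) \<Rightarrow> (real \<Rightarrow> complex) \<Rightarrow> complex ^ 2" where
  "Gamma1 S v f = vector [quasi0 S v f LeftEnd, quasi0 S v f RightEnd]"

definition L_infinity :: "sl_coeffs \<Rightarrow> (endpoint \<Rightarrow> real \<Rightarrow> real) \<Rightarrow> sl_op" where
  "L_infinity S u = restrict_op (Lmax S)
     {f \<in> Dmax S. quasi1 S u f LeftEnd = 0 \<and> quasi1 S u f RightEnd = 0}"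

definition hermitian :: "complex ^ 2 ^ 2 \<Rightarrow> bool" where
  "hermitian A \<longleftrightarrow> (\<forall>i j. A $ i $ j = cnj (A $ j $ i))"

definition L_ext ::
    "sl_coeffs \<Rightarrow> (endpoint \<Rightarrow> real \<Rightarrow> real) \<Rightarrow> (endpoint \<Rightarrow> real \<Rightarrow> real) \<Rightarrow> complex ^ 2 ^ 2 \<Rightarrow> sl_op" where
  "L_ext S u v A = restrict_op (Lmax S) {f \<in> Dmax S. A *v Gamma0 S u f = Gamma1 S v f}"

end

theory Submission
  imports Defs
begin

text \<open>For \<open>\<lambda>\<close> in the resolvent set of \<open>L\<^sub>\<infinity>\<close> the map \<open>\<Gamma>\<^sub>0'\<close> is injective on the solutions of
  \<open>(\<ell> - \<lambda>) y = 0\<close>. A two-dimensional eigenspace therefore contains every solution, in particular \<open>u\<^sub>1\<close>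
  and \<open>u\<^sub>2\<close>, and their boundary conditions determine the matrix: \<open>\<Theta>\<^sub>1\<^sub>1 u\<^sub>1\<^sup>[\<^sup>1\<^sup>] = u\<^sub>2\<^sup>[\<^sup>1\<^sup>]\<close>,
  \<open>\<Theta>\<^sub>1\<^sub>2 u\<^sub>1\<^sup>[\<^sup>1\<^sup>] = 1\<close>, \<open>\<Theta>\<^sub>2\<^sub>2 u\<^sub>1\<^sup>[\<^sup>1\<^sup>] = u\<^sub>1\<^sup>[\<^sup>0\<^sup>]\<close>, while \<open>\<Theta>\<^sub>2\<^sub>1 u\<^sub>1\<^sup>[\<^sup>1\<^sup>] = 1\<close> expresses that the
  Wronskian of \<open>u\<^sub>1\<close> and \<open>u\<^sub>2\<close> is \<open>1\<close>. The boundary values are additive because, at limit-circle endpoints,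
  the Lagrange identity makes the limits defining them exist.\<close>

section \<open>Absolutely continuous functions\<close>

lemma abs_cont_onE:
  assumes "abs_cont_on c d f" "\<epsilon> > 0"
  obtains \<delta> where "\<delta> > 0" "\<And>D T. D division_of T \<Longrightarrow> T \<subseteq> {c..d} \<Longrightarrow>
      (\<Sum>k\<in>D. measure lborel k) < \<delta> \<Longrightarrow> (\<Sum>k\<in>D. norm (f (Sup k) - f (Inf k))) < \<epsilon>"
proof -
  obtain \<delta> where "\<delta> > 0" and "\<forall>D T. D division_of T \<and> T \<subseteq> {c..d} \<and> (\<Sum>k\<in>D. measure lborel k) < \<delta> \<longrightarrow>
        (\<Sum>k\<in>D. norm (f (Sup k) - f (Inf k))) < \<epsilon>"
    using assms unfolding abs_cont_on_def by blast
  then show thesis by (intro that[of \<delta>]) auto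
qed

text \<open>The increments of \<open>h\<close> over any division are summed against those of
  \<open>f\<close> and \<open>g\<close>, so the smaller of their two \<open>\<delta>\<close>'s for
  \<open>\<epsilon> / (2 * M)\<close> works. Linear combinations, conjugates and products all reduce
  to this estimate.\<close>

lemma abs_cont_on_dominated:
  assumes f: "abs_cont_on c d f" and g: "abs_cont_on c d g" and "M > 0"
    and le: "\<And>x y. x \<in> {c..d} \<Longrightarrow> y \<in> {c..d} \<Longrightarrow>
               norm (h y - h x) \<le> M * (norm (f y - f x) + norm (g y - g x))"
  shows "abs_cont_on c d h"
  unfolding abs_cont_on_def
proof (intro allI impI)
  fix \<epsilon> :: real assume "\<epsilon> > 0"
  then have e: "\<epsilon> / (2 * M) > 0" using \<open>M > 0\<close> by simp
  obtain \<delta>1 where d1: "\<delta>1 > 0" "\<And>D T. D division_of T \<Longrightarrow> T \<subseteq> {c..d} \<Longrightarrow>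
      (\<Sum>k\<in>D. measure lborel k) < \<delta>1 \<Longrightarrow> (\<Sum>k\<in>D. norm (f (Sup k) - f (Inf k))) < \<epsilon> / (2 * M)"
    using abs_cont_onE[OF f e] by blast
  obtain \<delta>2 where d2: "\<delta>2 > 0" "\<And>D T. D division_of T \<Longrightarrow> T \<subseteq> {c..d} \<Longrightarrow>
      (\<Sum>k\<in>D. measure lborel k) < \<delta>2 \<Longrightarrow> (\<Sum>k\<in>D. norm (g (Sup k) - g (Inf k))) < \<epsilon> / (2 * M)"
    using abs_cont_onE[OF g e] by blast
  show "\<exists>\<delta>>0. \<forall>D T. D division_of T \<and> T \<subseteq> {c..d} \<and> (\<Sum>k\<in>D. measure lborel k) < \<delta> \<longrightarrow>
        (\<Sum>k\<in>D. norm (h (Sup k) - h (Inf k))) < \<epsilon>"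
  proof (intro exI[of _ "min \<delta>1 \<delta>2"] conjI allI impI)
    fix D T assume *: "D division_of T \<and> T \<subseteq> {c..d} \<and> (\<Sum>k\<in>D. measure lborel k) < min \<delta>1 \<delta>2"
    \<comment> \<open>Division members are nonempty closed boxes, so their endpoints lie in
      \<open>{c..d}\<close>, where \<open>le\<close> is available.\<close>
    have "Sup k \<in> {c..d} \<and> Inf k \<in> {c..d}" if k: "k \<in> D" for k
    proof -
      have D: "D division_of T" and "T \<subseteq> {c..d}" using * by auto
      obtain a b where ab: "k = cbox a b" using division_ofD(4)[OF D k] by auto
      have "k \<noteq> {}" "k \<subseteq> {c..d}" using division_ofD(2,3)[OF D k] \<open>T \<subseteq> {c..d}\<close> by auto
      with ab show ?thesis by auto
    qed
    then have "(\<Sum>k\<in>D. norm (h (Sup k) - h (Inf k)))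
      \<le> (\<Sum>k\<in>D. M * (norm (f (Sup k) - f (Inf k)) + norm (g (Sup k) - g (Inf k))))"
      by (intro sum_mono le) auto
    also have "\<dots> = M * ((\<Sum>k\<in>D. norm (f (Sup k) - f (Inf k))) + (\<Sum>k\<in>D. norm (g (Sup k) - g (Inf k))))"
      by (simp only: sum_distrib_left sum.distrib distrib_left)
    also have "\<dots> < M * (\<epsilon> / (2 * M) + \<epsilon> / (2 * M))"
      using d1(2) d2(2) * \<open>M > 0\<close> by (intro mult_strict_left_mono add_strict_mono) auto
    also have "\<dots> = \<epsilon>" using \<open>M > 0\<close> by (simp add: field_simps)
    finally show "(\<Sum>k\<in>D. norm (h (Sup k) - h (Inf k))) < \<epsilon>" .
  qed (use d1 d2 in auto)
qed

lemma abs_cont_on_lincomb: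
  assumes "abs_cont_on c d f" "abs_cont_on c d g"
  shows "abs_cont_on c d (\<lambda>x. \<alpha> * f x + \<beta> * g x)"
\<comment> \<open>The summand \<open>1\<close> keeps the constant positive when both coefficients
  vanish.\<close>
proof (rule abs_cont_on_dominated[OF assms, of "norm \<alpha> + norm \<beta> + 1"])
  fix x y
  have "norm ((\<alpha> * f y + \<beta> * g y) - (\<alpha> * f x + \<beta> * g x))
      = norm (\<alpha> * (f y - f x) + \<beta> * (g y - g x))"
    by (simp add: algebra_simps)
  also have "\<dots> \<le> norm \<alpha> * norm (f y - f x) + norm \<beta> * norm (g y - g x)"
    by (metis norm_triangle_ineq norm_mult)
  also have "\<dots> \<le> (norm \<alpha> + norm \<beta> + 1) * norm (f y - f x) + (norm \<alpha> + norm \<beta> + 1) * norm (g y - g x)"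
    by (intro add_mono mult_right_mono) auto
  finally show "norm ((\<alpha> * f y + \<beta> * g y) - (\<alpha> * f x + \<beta> * g x))
     \<le> (norm \<alpha> + norm \<beta> + 1) * (norm (f y - f x) + norm (g y - g x))"
    by (simp add: algebra_simps)
qed (use norm_ge_zero[of \<alpha>] norm_ge_zero[of \<beta>] in linarith)

lemma abs_cont_on_cnj:
  assumes "abs_cont_on c d f"
  shows "abs_cont_on c d (\<lambda>x. cnj (f x))"
proof (rule abs_cont_on_dominated[OF assms assms, of 1])
  fix x y
  have "norm (cnj (f y) - cnj (f x)) = norm (f y - f x)"
    by (metis complex_cnj_diff complex_mod_cnj)
  then show "norm (cnj (f y) - cnj (f x)) \<le> 1 * (norm (f y - f x) + norm (f y - f x))"
    by simp
qed simp

lemma abs_cont_on_imp_continuous_on: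
  assumes "abs_cont_on c d f"
  shows "continuous_on {c..d} f"
  unfolding continuous_on_iff
proof (intro ballI allI impI)
  fix x and e :: real assume x: "x \<in> {c..d}" and e: "e > 0"
  obtain \<delta> where d: "\<delta> > 0" "\<And>D T. D division_of T \<Longrightarrow> T \<subseteq> {c..d} \<Longrightarrow>
      (\<Sum>k\<in>D. measure lborel k) < \<delta> \<Longrightarrow> (\<Sum>k\<in>D. norm (f (Sup k) - f (Inf k))) < e"
    using abs_cont_onE[OF assms e] by blast
  have *: "norm (f z - f y) < e" if "y \<le> z" "z - y < \<delta>" "y \<in> {c..d}" "z \<in> {c..d}" for y z
  proof -
    have "{{y..z}} division_of {y..z}"
      using division_of_self[of y z] that by simp
    then show ?thesis using d(2)[of "{{y..z}}" "{y..z}"] that by simp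
  qed
  show "\<exists>\<delta>>0. \<forall>x'\<in>{c..d}. dist x' x < \<delta> \<longrightarrow> dist (f x') (f x) < e"
  proof (intro exI conjI ballI impI)
    fix y assume "y \<in> {c..d}" "dist y x < \<delta>"
    then show "dist (f y) (f x) < e"
      using *[of x y] *[of y x] x by (cases "x \<le> y") (auto simp: dist_norm norm_minus_commute)
  qed (fact d(1))
qed

text \<open>Splitting the increment as \<open>(f y - f x) * g y + f x * (g y - g x)\<close> leaves
  factors that are bounded, since both functions are continuous on a compact interval.\<close>

lemma abs_cont_on_mult:
  assumes f: "abs_cont_on c d f" and g: "abs_cont_on c d g"
  shows "abs_cont_on c d (\<lambda>x. f x * g x)"
proof -
  have "bounded (f ` {c..d})" "bounded (g ` {c..d})"
    using f g by (auto intro!: compact_imp_bounded compact_continuous_image abs_cont_on_imp_continuous_on)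
  then obtain M1 M2 where M: "\<And>x. x \<in> {c..d} \<Longrightarrow> norm (f x) \<le> M1" "\<And>x. x \<in> {c..d} \<Longrightarrow> norm (g x) \<le> M2"
    unfolding bounded_iff by (metis imageI)
  \<comment> \<open>Absolute values and the summand \<open>1\<close> guarantee \<open>M > 0\<close>;
    on an empty interval the bounds \<open>M1\<close> and \<open>M2\<close> could be
    negative.\<close>
  define M where "M = \<bar>M1\<bar> + \<bar>M2\<bar> + 1"
  have fM: "norm (f x) \<le> M" and gM: "norm (g x) \<le> M" if "x \<in> {c..d}" for x
    using M(1)[OF that] M(2)[OF that] by (auto simp: M_def)
  show ?thesis
  proof (rule abs_cont_on_dominated[OF f g, of M])
    fix x y assume xy: "x \<in> {c..d}" "y \<in> {c..d}"
    have "norm (f y * g y - f x * g x) = norm ((f y - f x) * g y + f x * (g y - g x))"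
      by (simp add: algebra_simps)
    also have "\<dots> \<le> norm (f y - f x) * norm (g y) + norm (f x) * norm (g y - g x)"
      by (metis norm_triangle_ineq norm_mult)
    also have "\<dots> \<le> norm (f y - f x) * M + M * norm (g y - g x)"
      using fM gM xy by (intro add_mono mult_left_mono mult_right_mono) auto
    finally show "norm (f y * g y - f x * g x) \<le> M * (norm (f y - f x) + norm (g y - g x))"
      by (simp add: algebra_simps)
  qed (simp add: M_def)
qed

text \<open>Henstock's gauge argument: tags outside \<^term>\<open>N\<close> are handled by differentiability, while the
  intervals tagged in \<^term>\<open>N\<close> lie in an open set of small measure, where absolute continuity applies.\<close>

theorem abs_cont_on_FTC:
  assumes ac: "abs_cont_on c d h" and "c \<le> d" and N: "negligible N"
    and deriv: "\<And>x. x \<in> {c..d} - N \<Longrightarrow> (h has_vector_derivative h' x) (at x within {c..d})"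
  shows "(h' has_integral (h d - h c)) {c..d}"
proof (cases "c < d")
  case False
  then have "c = d" using \<open>c \<le> d\<close> by simp
  then show ?thesis by (simp add: has_integral_refl(2))
next
  case True
  \<comment> \<open>With the value \<open>0\<close> on \<open>N\<close>, tags in \<open>N\<close>
    contribute only the increments of \<open>h\<close> to the error. Changing the integrand on a
    null set restores \<open>h'\<close> at the end.\<close>
  define g where "g x = (if x \<in> N then 0 else h' x)" for x
  have "(g has_integral (h d - h c)) (cbox c d)"
    unfolding has_integral
  proof (intro allI impI)
    fix e :: real assume "e > 0"
    \<comment> \<open>Local errors of size \<open>\<epsilon>\<close> times length add up to at most
      \<open>e / 2\<close>; the other half is for the tags in \<open>N\<close>.\<close>
    define \<epsilon> where "\<epsilon> = e / (2 * (d - c))"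
    have "\<epsilon> > 0" using \<open>e > 0\<close> True by (simp add: \<epsilon>_def)
    obtain \<delta> where \<delta>: "\<delta> > 0" "\<And>D T. D division_of T \<Longrightarrow> T \<subseteq> {c..d} \<Longrightarrow>
      (\<Sum>k\<in>D. measure lborel k) < \<delta> \<Longrightarrow> (\<Sum>k\<in>D. norm (h (Sup k) - h (Inf k))) < e / 2"
      using abs_cont_onE[OF ac, of "e / 2"] \<open>e > 0\<close> by auto
    have "N \<in> null_sets lebesgue" using N by (simp add: negligible_iff_null_sets)
    then obtain U where U: "open U" "N \<subseteq> U" "U - N \<in> lmeasurable" "emeasure lebesgue (U - N) < ennreal \<delta>"
      using sets_lebesgue_outer_open[of N \<delta>] \<delta>(1) by blast
    have Um: "U \<in> sets lebesgue" using U(1) by simp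
    have "emeasure lebesgue U = emeasure lebesgue (U - N)"
      using \<open>N \<in> null_sets lebesgue\<close> Um by (simp add: emeasure_Diff_null_set)
    then have U\<delta>: "emeasure lebesgue U < ennreal \<delta>" using U(4) by simp
    \<comment> \<open>The straddle estimate: the tag may lie anywhere in \<open>{y..z}\<close>, so
      the error is split at \<open>x\<close> into a left and a right part, each bounded by
      differentiability at \<open>x\<close>.\<close>
    have "\<exists>r>0. (x \<notin> N \<longrightarrow> (\<forall>y z. x \<in> {y..z} \<and> {y..z} \<subseteq> ball x r \<and> {y..z} \<subseteq> {c..d} \<longrightarrow>
              norm ((z - y) *\<^sub>R h' x - (h z - h y)) \<le> \<epsilon> * (z - y)))
            \<and> (x \<in> N \<longrightarrow> ball x r \<subseteq> U)" if "x \<in> {c..d}" for x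
    proof (cases "x \<in> N")
      case True
      then show ?thesis using U(1,2) open_contains_ball by (metis subsetD)
    next
      case False
      then have "(h has_vector_derivative h' x) (at x within {c..d})" using deriv that by simp
      then obtain r where r: "r > 0"
        "\<And>y. y \<in> {c..d} \<Longrightarrow> norm (y - x) < r \<Longrightarrow> norm (h y - h x - (y - x) *\<^sub>R h' x) \<le> \<epsilon> * norm (y - x)"
        using \<open>\<epsilon> > 0\<close> unfolding has_vector_derivative_def has_derivative_within_alt by metis
      show ?thesis
      proof (intro exI[of _ r] conjI impI allI)
        fix y z assume yz: "x \<in> {y..z} \<and> {y..z} \<subseteq> ball x r \<and> {y..z} \<subseteq> {c..d}"
        then have "y \<le> x" "x \<le> z" by auto
        then have "y \<in> {y..z}" "z \<in> {y..z}" by auto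
        then have "y \<in> ball x r" "z \<in> ball x r" "y \<in> {c..d}" "z \<in> {c..d}" using yz by blast+
        then have A: "norm (h y - h x - (y - x) *\<^sub>R h' x) \<le> \<epsilon> * norm (y - x)"
          and B: "norm (h z - h x - (z - x) *\<^sub>R h' x) \<le> \<epsilon> * norm (z - x)"
          using r(2)[of y] r(2)[of z] by (simp_all add: dist_norm norm_minus_commute)
        have "(z - y) *\<^sub>R h' x - (h z - h y)
           = (h y - h x - (y - x) *\<^sub>R h' x) - (h z - h x - (z - x) *\<^sub>R h' x)"
          by (simp add: algebra_simps)
        then have "norm ((z - y) *\<^sub>R h' x - (h z - h y)) \<le> \<epsilon> * norm (y - x) + \<epsilon> * norm (z - x)"
          using order_trans[OF norm_triangle_ineq4 add_mono[OF A B]] by metis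
        also have "\<dots> = \<epsilon> * (z - y)" using \<open>y \<le> x\<close> \<open>x \<le> z\<close> by (simp add: algebra_simps)
        finally show "norm ((z - y) *\<^sub>R h' x - (h z - h y)) \<le> \<epsilon> * (z - y)" .
      qed (use r False in auto)
    qed
    then obtain r where r: "\<And>x. x \<in> {c..d} \<Longrightarrow> r x > 0"
      "\<And>x y z. \<lbrakk>x \<in> {c..d}; x \<notin> N; x \<in> {y..z}; {y..z} \<subseteq> ball x (r x); {y..z} \<subseteq> {c..d}\<rbrakk> \<Longrightarrow>
              norm ((z - y) *\<^sub>R h' x - (h z - h y)) \<le> \<epsilon> * (z - y)"
      "\<And>x. x \<in> {c..d} \<Longrightarrow> x \<in> N \<Longrightarrow> ball x (r x) \<subseteq> U"
      by metis
    \<comment> \<open>The radius \<open>1\<close> outside \<open>{c..d}\<close> is arbitrary; it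
      only makes \<open>\<gamma>\<close> a gauge on the whole line.\<close>
    define \<gamma> where "\<gamma> x = ball x (if x \<in> {c..d} then r x else 1)" for x
    show "\<exists>\<gamma>. gauge \<gamma> \<and> (\<forall>p. p tagged_division_of cbox c d \<and> \<gamma> fine p \<longrightarrow>
            norm ((\<Sum>(x, k)\<in>p. measure lborel k *\<^sub>R g x) - (h d - h c)) < e)"
    proof (intro exI[of _ \<gamma>] conjI allI impI)
      show "gauge \<gamma>" unfolding \<gamma>_def gauge_def using r(1) by auto
      fix p assume "p tagged_division_of cbox c d \<and> \<gamma> fine p"
      then have p: "p tagged_division_of cbox c d" and fine: "\<gamma> fine p" by auto
      note finp = tagged_division_of_finite[OF p]
      define q where "q = {xk \<in> p. fst xk \<in> N}"
      let ?F = "\<lambda>(x, k). measure lborel k *\<^sub>R g x - (h (Sup k) - h (Inf k))"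
      have "(\<Sum>(x, k)\<in>p. measure lborel k *\<^sub>R g x) - (h d - h c) = sum ?F p"
        using additive_tagged_division_1[of c d p h] p \<open>c \<le> d\<close>
        by (simp add: sum_subtractf case_prod_beta)
      also have "\<dots> = sum ?F (p - q) + sum ?F q"
        using finp by (intro sum.subset_diff) (auto simp: q_def)
      finally have split: "(\<Sum>(x, k)\<in>p. measure lborel k *\<^sub>R g x) - (h d - h c) = sum ?F (p - q) + sum ?F q" .
      have "norm (sum ?F (p - q)) \<le> (\<Sum>xk\<in>p - q. \<epsilon> * (case xk of (x, k) \<Rightarrow> measure lborel k))"
      proof (rule order_trans[OF norm_sum sum_mono])
        fix xk assume "xk \<in> p - q"
        then obtain x k where xk: "xk = (x, k)" "(x, k) \<in> p" "x \<notin> N" by (cases xk) (auto simp: q_def)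
        obtain y z where k: "k = cbox y z" using tagged_division_ofD(4)[OF p xk(2)] by blast
        have sub: "x \<in> k" "k \<subseteq> cbox c d" using tagged_division_ofD(2,3)[OF p xk(2)] by auto
        moreover have "k \<subseteq> \<gamma> x" using fine xk(2) by (auto simp: fine_def)
        ultimately have "k \<subseteq> ball x (r x)" "x \<in> {c..d}" by (auto simp: \<gamma>_def split: if_splits)
        then have "norm ((z - y) *\<^sub>R h' x - (h z - h y)) \<le> \<epsilon> * (z - y)"
          using r(2)[of x y z] xk(3) sub k by auto
        moreover have "y \<le> z" using k sub by auto
        ultimately show "norm (?F xk) \<le> \<epsilon> * (case xk of (x, k) \<Rightarrow> measure lborel k)"
          using xk k by (simp add: g_def)
      qed
      also have "\<dots> \<le> (\<Sum>xk\<in>p. \<epsilon> * (case xk of (x, k) \<Rightarrow> measure lborel k))"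
        using finp \<open>\<epsilon> > 0\<close> by (intro sum_mono2) (auto simp: case_prod_beta)
      also have "\<dots> = \<epsilon> * (d - c)"
        using additive_content_tagged_division[OF p] \<open>c \<le> d\<close>
        by (simp add: sum_distrib_left[symmetric])
      also have "\<dots> = e / 2" using True by (simp add: \<epsilon>_def divide_simps)
      finally have 1: "norm (sum ?F (p - q)) \<le> e / 2" .
      have qp: "q tagged_partial_division_of cbox c d"
        using p tagged_partial_division_subset[of p "cbox c d" q]
        by (auto simp: q_def tagged_division_of_def)
      then have qt: "q tagged_division_of \<Union>(snd ` q)"
        by (rule tagged_partial_division_of_Union_self)
      then have qd: "snd ` q division_of \<Union>(snd ` q)"
        by (rule division_of_tagged_division)
      have qU: "\<Union>(snd ` q) \<subseteq> U"
      proof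
        fix y assume "y \<in> \<Union>(snd ` q)"
        then obtain x k where xk: "(x, k) \<in> p" "x \<in> N" "y \<in> k" by (auto simp: q_def)
        have "x \<in> {c..d}" using tagged_division_ofD(2,3)[OF p xk(1)] by auto
        moreover have "k \<subseteq> \<gamma> x" using fine xk(1) by (auto simp: fine_def)
        ultimately show "y \<in> U" using r(3)[of x] xk by (auto simp: \<gamma>_def)
      qed
      have qc: "\<Union>(snd ` q) \<subseteq> {c..d}"
        using tagged_division_ofD(3)[OF p] by (fastforce simp: q_def)
      have "(\<Sum>k\<in>snd ` q. measure lborel k) = measure lebesgue (\<Union>(snd ` q))"
      proof -
        have "measure lborel k = measure lebesgue k" if "k \<in> snd ` q" for k
          using division_ofD(4)[OF qd that] by (auto simp: measure_completion)
        then show ?thesis using content_division[OF qd] by simp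
      qed
      also have "\<dots> < \<delta>"
      proof -
        have "emeasure lebesgue (\<Union>(snd ` q)) \<le> emeasure lebesgue U"
          using qU Um by (rule emeasure_mono)
        then have "emeasure lebesgue (\<Union>(snd ` q)) < ennreal \<delta>" using U\<delta> by simp
        then show ?thesis unfolding measure_def
          using \<delta>(1) by (cases "emeasure lebesgue (\<Union>(snd ` q))") (auto simp: ennreal_less_iff)
      qed
      finally have "(\<Sum>k\<in>snd ` q. norm (h (Sup k) - h (Inf k))) < e / 2"
        using \<delta>(2)[OF qd qc] by simp
      moreover have "(\<Sum>(x, k)\<in>q. norm (h (Sup k) - h (Inf k))) = (\<Sum>k\<in>snd ` q. norm (h (Sup k) - h (Inf k)))"
      proof -
        \<comment> \<open>Passing from tagged pairs to their intervals requires a summand that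
          vanishes on degenerate boxes. Singletons give \<open>0\<close> anyway; the empty box needs
          the explicit case because \<open>Sup\<close> and \<open>Inf\<close> of it carry no
          information.\<close>
        let ?d = "\<lambda>k. if k = {} then 0 else norm (h (Sup k) - h (Inf k))"
        have ne: "k \<noteq> {}" if "(x, k) \<in> q" for x k
          using tagged_division_ofD(2)[OF qt that] by auto
        have "(\<Sum>(x, k)\<in>q. ?d k) = (\<Sum>k\<in>snd ` q. ?d k)"
          by (rule sum.over_tagged_division_lemma[OF qt]) auto
        moreover have "(\<Sum>(x, k)\<in>q. ?d k) = (\<Sum>(x, k)\<in>q. norm (h (Sup k) - h (Inf k)))"
          using ne by (intro sum.cong) auto
        moreover have "(\<Sum>k\<in>snd ` q. ?d k) = (\<Sum>k\<in>snd ` q. norm (h (Sup k) - h (Inf k)))"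
          using ne by (intro sum.cong) auto
        ultimately show ?thesis by simp
      qed
      moreover have "norm (sum ?F q) \<le> (\<Sum>(x, k)\<in>q. norm (h (Sup k) - h (Inf k)))"
        by (rule order_trans[OF norm_sum sum_mono])
          (auto simp: q_def g_def norm_minus_commute)
      ultimately have "norm (sum ?F q) < e / 2" by linarith
      then show "norm ((\<Sum>(x, k)\<in>p. measure lborel k *\<^sub>R g x) - (h d - h c)) < e"
        unfolding split using 1 norm_triangle_ineq[of "sum ?F (p - q)" "sum ?F q"] by linarith
    qed
  qed
  then show ?thesis
    using has_integral_spike[OF N, of "{c..d}" h' g] by (auto simp: g_def)
qed

section \<open>Solutions and the Lagrange identity\<close>

text \<open>Lebesgue measure is complete, so the exceptional set is itself measurable and null
  rather than merely contained in a null set.\<close>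

lemma AE_lebesgue_on_iff_negligible:
  assumes "U \<in> sets lebesgue"
  shows "(AE x in lebesgue_on U. P x) \<longleftrightarrow> negligible {x \<in> U. \<not> P x}"
proof -
  have "(AE x in lebesgue_on U. P x) \<longleftrightarrow> (AE x in lebesgue. x \<in> U \<longrightarrow> P x)"
    using assms by (intro AE_restrict_space_iff) simp
  also have "\<dots> \<longleftrightarrow> {x \<in> space lebesgue. \<not> (x \<in> U \<longrightarrow> P x)} \<in> null_sets lebesgue"
    by (rule completion.AE_iff_null_sets)
  also have "{x \<in> space lebesgue. \<not> (x \<in> U \<longrightarrow> P x)} = {x \<in> U. \<not> P x}" by auto
  finally show ?thesis by (simp add: negligible_iff_null_sets)
qed

text \<open>The set of disagreement is open and negligible, hence empty.\<close>

lemma AE_eq_continuous_imp_eq: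
  fixes f g :: "'a::euclidean_space \<Rightarrow> 'b::real_normed_vector"
  assumes U: "open U" and "continuous_on U f" "continuous_on U g"
    and ae: "AE x in lebesgue_on U. f x = g x" and "x \<in> U"
  shows "f x = g x"
proof (rule ccontr)
  assume "f x \<noteq> g x"
  have "continuous_on U (\<lambda>x. f x - g x)" using assms by (intro continuous_intros)
  then have "open ((\<lambda>x. f x - g x) -` (- {0}) \<inter> U)"
    using U by (subst (asm) continuous_on_open_vimage[OF U]) auto
  moreover have "(\<lambda>x. f x - g x) -` (- {0}) \<inter> U = {x \<in> U. \<not> f x = g x}" by auto
  ultimately have "open {x \<in> U. \<not> f x = g x}" by simp
  moreover have "negligible {x \<in> U. \<not> f x = g x}"
    using ae U by (subst (asm) AE_lebesgue_on_iff_negligible) auto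
  ultimately show False using open_not_negligible \<open>x \<in> U\<close> \<open>f x \<noteq> g x\<close> by blast
qed

section \<open>Locally absolutely continuous functions and uniqueness of the
  quasi-derivative\<close>

lemma open_ivl [simp]: "open (ivl S)"
  by (simp add: ivl_def)

lemma ivl_sets_lebesgue [simp]: "ivl S \<in> sets lebesgue"
  by (simp add: borel_open)

lemma Icc_subset_ivl:
  assumes "c \<in> ivl S" "d \<in> ivl S"
  shows "{c..d} \<subseteq> ivl S"
proof
  fix x assume "x \<in> {c..d}"
  then have "ereal c \<le> ereal x" "ereal x \<le> ereal d" by auto
  moreover have "lend S < ereal c" "ereal d < rend S" using assms by (auto simp: ivl_def einterval_iff)
  ultimately show "x \<in> ivl S"
    unfolding ivl_def einterval_iff by (metis less_le_trans le_less_trans)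
qed

lemma AC_locD: "f \<in> AC_loc S \<Longrightarrow> {c..d} \<subseteq> ivl S \<Longrightarrow> abs_cont_on c d f"
  by (simp add: AC_loc_def)

lemma AC_loc_continuous_on:
  assumes "f \<in> AC_loc S"
  shows "continuous_on (ivl S) f"
proof (rule continuous_at_imp_continuous_on, rule ballI)
  fix x assume "x \<in> ivl S"
  then obtain e where "e > 0" "cball x e \<subseteq> ivl S"
    using open_contains_cball open_ivl by blast
  then have "{x - e..x + e} \<subseteq> ivl S" by (simp add: cball_eq_atLeastAtMost)
  then have "continuous_on {x - e..x + e} f"
    using AC_locD[OF assms] abs_cont_on_imp_continuous_on by blast
  moreover have "x \<in> interior {x - e..x + e}" using \<open>e > 0\<close> by simp
  ultimately show "isCont f x" by (rule continuous_on_interior)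
qed

lemma AC_loc_lincomb:
  "f \<in> AC_loc S \<Longrightarrow> g \<in> AC_loc S \<Longrightarrow> (\<lambda>x. \<alpha> * f x + \<beta> * g x) \<in> AC_loc S"
  by (auto simp: AC_loc_def intro!: abs_cont_on_lincomb)

lemma AC_loc_cnj: "f \<in> AC_loc S \<Longrightarrow> (\<lambda>x. cnj (f x)) \<in> AC_loc S"
  by (auto simp: AC_loc_def intro!: abs_cont_on_cnj)

lemma AC_loc_eqI:
  assumes "f \<in> AC_loc S" "g \<in> AC_loc S" "AE x in lebesgue_on (ivl S). f x = g x"
  shows "f = g"
proof
  fix x
  show "f x = g x"
  proof (cases "x \<in> ivl S")
    case True
    then show ?thesis
      using AE_eq_continuous_imp_eq[OF open_ivl _ _ assms(3)] assms(1,2) by (simp add: AC_loc_continuous_on)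
  next
    case False
    then show ?thesis using assms(1,2) by (simp add: AC_loc_def)
  qed
qed

text \<open>Two continuous representatives of the same almost everywhere defined function coincide,
  which makes the definite description in \<open>pdiff\<close> meaningful.\<close>

lemma is_pdiff_unique:
  assumes "is_pdiff S f g" "is_pdiff S f h"
  shows "g = h"
proof (rule AC_loc_eqI)
  show "g \<in> AC_loc S" "h \<in> AC_loc S" using assms by (auto simp: is_pdiff_def)
  have "AE x in lebesgue_on (ivl S). g x = cp S x *\<^sub>R vector_derivative f (at x)"
    "AE x in lebesgue_on (ivl S). h x = cp S x *\<^sub>R vector_derivative f (at x)"
    using assms by (auto simp: is_pdiff_def)
  then show "AE x in lebesgue_on (ivl S). g x = h x" by eventually_elim simp
qed

lemma pdiff_eqI: "is_pdiff S f g \<Longrightarrow> pdiff S f = g"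
  unfolding pdiff_def using is_pdiff_unique by (intro the_equality) auto

text \<open>The second-order equation as a first-order system for the pair of a function and its
  quasi-derivative. Carrying \<open>F\<close> explicitly avoids the definite description in
  \<open>pdiff\<close>, and pairs can be combined linearly or conjugated directly.\<close>

definition solves_system :: "sl_coeffs \<Rightarrow> complex \<Rightarrow> (real \<Rightarrow> complex) \<Rightarrow> (real \<Rightarrow> complex) \<Rightarrow> bool" where
  "solves_system S l f F \<longleftrightarrow> f \<in> AC_loc S \<and> F \<in> AC_loc S \<and>
     (AE x in lebesgue_on (ivl S). \<exists>D. (f has_vector_derivative D) (at x) \<and> F x = cp S x *\<^sub>R D) \<and>
     (AE x in lebesgue_on (ivl S).
        (F has_vector_derivative - ((l * cw S x + cq S x) * f x)) (at x))"

lemma solves_system_is_pdiff: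
  assumes "solves_system S l f F"
  shows "is_pdiff S f F"
proof -
  have *: "AE x in lebesgue_on (ivl S). \<exists>D. (f has_vector_derivative D) (at x) \<and> F x = cp S x *\<^sub>R D"
     "AE x in lebesgue_on (ivl S). (F has_vector_derivative - ((l * cw S x + cq S x) * f x)) (at x)"
    using assms by (auto simp: solves_system_def)
  have "AE x in lebesgue_on (ivl S).
        f differentiable (at x) \<and> F x = cp S x *\<^sub>R vector_derivative f (at x)"
    using *(1) by eventually_elim (auto simp: vector_derivative_at intro: differentiableI_vector)
  moreover have "AE x in lebesgue_on (ivl S). F differentiable (at x)"
    using *(2) by eventually_elim (auto intro: differentiableI_vector)
  ultimately show ?thesis using assms by (auto simp: is_pdiff_def solves_system_def)
qed

text \<open>Since \<open>cw S\<close> is positive almost everywhere, the division by it in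
  \<open>ell\<close> can be undone there.\<close>

lemma solution_iff_solves_system:
  assumes "admissible S"
  shows "solution S l f \<longleftrightarrow> solves_system S l f (pdiff S f)"
proof
  have w: "AE x in lebesgue_on (ivl S). cw S x > 0"
    using assms by (auto simp: admissible_def)
  {
    assume sol: "solution S l f"
    then obtain F where F: "is_pdiff S f F" by (auto simp: solution_def AC2_loc_def)
    note pF = pdiff_eqI[OF F]
    have 1: "AE x in lebesgue_on (ivl S). f differentiable (at x) \<and> F x = cp S x *\<^sub>R vector_derivative f (at x)"
      and 2: "AE x in lebesgue_on (ivl S). F differentiable (at x)" and "F \<in> AC_loc S"
      using F by (auto simp: is_pdiff_def)
    have 3: "AE x in lebesgue_on (ivl S). ell S f x = l * f x" and "f \<in> AC_loc S"
      using sol by (auto simp: solution_def AC2_loc_def)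
    have "AE x in lebesgue_on (ivl S). \<exists>D. (f has_vector_derivative D) (at x) \<and> F x = cp S x *\<^sub>R D"
      using 1 by eventually_elim (auto simp: vector_derivative_works)
    moreover have "AE x in lebesgue_on (ivl S). (F has_vector_derivative - ((l * cw S x + cq S x) * f x)) (at x)"
      using 2 3 w
    proof eventually_elim
      case (elim x)
      let ?X = "vector_derivative F (at x) + cq S x *\<^sub>R f x"
      have "?X = - (cw S x *\<^sub>R (- (1 / cw S x) *\<^sub>R ?X))" using elim(3) by simp
      also have "\<dots> = - (cw S x *\<^sub>R (l * f x))" using elim(2) by (simp only: ell_def pF)
      finally have "?X = - (cw S x *\<^sub>R (l * f x))" .
      then have "vector_derivative F (at x) = - (cw S x *\<^sub>R (l * f x)) - cq S x *\<^sub>R f x"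
        by (simp only: eq_diff_eq)
      also have "\<dots> = - ((l * cw S x + cq S x) * f x)"
        by (simp add: scaleR_conv_of_real algebra_simps)
      finally have "vector_derivative F (at x) = - ((l * cw S x + cq S x) * f x)" .
      then show ?case using elim(1) by (simp add: vector_derivative_works)
    qed
    ultimately show "solves_system S l f (pdiff S f)"
      using pF \<open>F \<in> AC_loc S\<close> \<open>f \<in> AC_loc S\<close> by (simp add: solves_system_def)
  }
  {
    assume sys: "solves_system S l f (pdiff S f)"
    then have "AE x in lebesgue_on (ivl S). (pdiff S f has_vector_derivative - ((l * cw S x + cq S x) * f x)) (at x)"
      by (auto simp: solves_system_def)
    then have "AE x in lebesgue_on (ivl S). ell S f x = l * f x"
      using w by eventually_elim
        (simp add: ell_def vector_derivative_at scaleR_conv_of_real field_simps)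
    then show "solution S l f"
      using sys solves_system_is_pdiff[OF sys] by (auto simp: solution_def AC2_loc_def solves_system_def)
  }
qed

text \<open>Any second component that solves the system is the quasi-derivative, so exhibiting one
  also computes \<open>pdiff\<close>.\<close>

lemma solutionI:
  assumes "admissible S" "solves_system S l f F"
  shows "solution S l f" "pdiff S f = F"
  using assms solves_system_is_pdiff pdiff_eqI solution_iff_solves_system by metis+

lemma solves_system_lincomb:
  assumes "solves_system S l f F" "solves_system S l g G"
  shows "solves_system S l (\<lambda>x. \<alpha> * f x + \<beta> * g x) (\<lambda>x. \<alpha> * F x + \<beta> * G x)"
proof -
  have f: "f \<in> AC_loc S" "F \<in> AC_loc S"
    "AE x in lebesgue_on (ivl S). \<exists>D. (f has_vector_derivative D) (at x) \<and> F x = cp S x *\<^sub>R D"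
    "AE x in lebesgue_on (ivl S). (F has_vector_derivative - ((l * cw S x + cq S x) * f x)) (at x)"
    using assms(1) by (auto simp: solves_system_def)
  have g: "g \<in> AC_loc S" "G \<in> AC_loc S"
    "AE x in lebesgue_on (ivl S). \<exists>D. (g has_vector_derivative D) (at x) \<and> G x = cp S x *\<^sub>R D"
    "AE x in lebesgue_on (ivl S). (G has_vector_derivative - ((l * cw S x + cq S x) * g x)) (at x)"
    using assms(2) by (auto simp: solves_system_def)
  have "AE x in lebesgue_on (ivl S). \<exists>D. ((\<lambda>x. \<alpha> * f x + \<beta> * g x) has_vector_derivative D) (at x)
          \<and> \<alpha> * F x + \<beta> * G x = cp S x *\<^sub>R D"
    using f(3) g(3)
  proof eventually_elim
    case (elim x)
    then obtain D E where "(f has_vector_derivative D) (at x)" "F x = cp S x *\<^sub>R D"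
       "(g has_vector_derivative E) (at x)" "G x = cp S x *\<^sub>R E" by blast
    then show ?case
      by (intro exI[of _ "\<alpha> * D + \<beta> * E"] conjI has_vector_derivative_add has_vector_derivative_mult_right)
         (simp_all add: scaleR_conv_of_real algebra_simps)
  qed
  moreover have "AE x in lebesgue_on (ivl S). ((\<lambda>x. \<alpha> * F x + \<beta> * G x) has_vector_derivative
         - ((l * cw S x + cq S x) * (\<alpha> * f x + \<beta> * g x))) (at x)"
    using f(4) g(4)
  proof eventually_elim
    case (elim x)
    then have "((\<lambda>x. \<alpha> * F x + \<beta> * G x) has_vector_derivative
         \<alpha> * (- ((l * cw S x + cq S x) * f x)) + \<beta> * (- ((l * cw S x + cq S x) * g x))) (at x)"
      by (intro has_vector_derivative_add has_vector_derivative_mult_right)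
    then show ?case by (simp add: algebra_simps)
  qed
  ultimately show ?thesis
    unfolding solves_system_def using f(1,2) g(1,2) by (simp add: AC_loc_lincomb)
qed

text \<open>The coefficients are real, so conjugation affects only the spectral parameter.\<close>

lemma solves_system_cnj:
  assumes "solves_system S l f F"
  shows "solves_system S (cnj l) (\<lambda>x. cnj (f x)) (\<lambda>x. cnj (F x))"
proof -
  have f: "f \<in> AC_loc S" "F \<in> AC_loc S"
    "AE x in lebesgue_on (ivl S). \<exists>D. (f has_vector_derivative D) (at x) \<and> F x = cp S x *\<^sub>R D"
    "AE x in lebesgue_on (ivl S). (F has_vector_derivative - ((l * cw S x + cq S x) * f x)) (at x)"
    using assms by (auto simp: solves_system_def)
  have "AE x in lebesgue_on (ivl S). \<exists>D. ((\<lambda>x. cnj (f x)) has_vector_derivative D) (at x) \<and> cnj (F x) = cp S x *\<^sub>R D"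
    using f(3) by eventually_elim (auto intro: has_vector_derivative_cnj simp: scaleR_conv_of_real)
  moreover have "AE x in lebesgue_on (ivl S). ((\<lambda>x. cnj (F x)) has_vector_derivative
         - ((cnj l * cw S x + cq S x) * cnj (f x))) (at x)"
    using f(4)
  proof eventually_elim
    case (elim x)
    then have "((\<lambda>x. cnj (F x)) has_vector_derivative cnj (- ((l * cw S x + cq S x) * f x))) (at x)"
      by (rule has_vector_derivative_cnj)
    then show ?case by simp
  qed
  ultimately show ?thesis
    unfolding solves_system_def using f(1,2) by (simp add: AC_loc_cnj)
qed

lemma solution_lincomb:
  assumes "admissible S" "solution S l f" "solution S l g"
  shows "solution S l (\<lambda>x. \<alpha> * f x + \<beta> * g x)"
    and "pdiff S (\<lambda>x. \<alpha> * f x + \<beta> * g x) = (\<lambda>x. \<alpha> * pdiff S f x + \<beta> * pdiff S g x)"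
  using solutionI[OF assms(1) solves_system_lincomb] assms solution_iff_solves_system by auto

text \<open>\<open>cplx u\<close> is its own conjugate and \<open>l0\<close> is real, so the
  quasi-derivative and its conjugate both complete \<open>cplx u\<close> to a solution of the same
  system and agree by uniqueness. This removes the conjugates from the bracket with a reference
  solution.\<close>

lemma cnj_pdiff_real_solution:
  assumes "admissible S" "solution S (of_real l0) (cplx u)"
  shows "cnj (pdiff S (cplx u) x) = pdiff S (cplx u) x"
proof -
  have "solves_system S (of_real l0) (cplx u) (\<lambda>x. cnj (pdiff S (cplx u) x))"
    using solves_system_cnj[of S "of_real l0" "cplx u" "pdiff S (cplx u)"] assms
    by (simp add: solution_iff_solves_system)
  then have "pdiff S (cplx u) = (\<lambda>x. cnj (pdiff S (cplx u) x))"
    by (rule solutionI(2)[OF assms(1)])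
  then show ?thesis by metis
qed

section \<open>Wronskians and the Lagrange identity\<close>

text \<open>Unlike the bracket, the Wronskian is bilinear; both agree if the second argument is real.\<close>

definition wronskian :: "sl_coeffs \<Rightarrow> (real \<Rightarrow> complex) \<Rightarrow> (real \<Rightarrow> complex) \<Rightarrow> real \<Rightarrow> complex" where
  "wronskian S f g x = f x * pdiff S g x - pdiff S f x * g x"

lemma bracket_real_solution:
  assumes "admissible S" "solution S (of_real l0) (cplx u)"
  shows "bracket S f (cplx u) = wronskian S f (cplx u)"
  using cnj_pdiff_real_solution[OF assms] by (auto simp: bracket_def wronskian_def)

text \<open>In the derivative of the Wronskian the terms with \<open>cp S\<close> and those with
  \<open>cq S\<close> cancel, leaving only the difference of the spectral parameters. The
  fundamental theorem for absolutely continuous functions turns this almost everywhere identity into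
  an integral.\<close>

theorem wronskian_has_integral:
  assumes adm: "admissible S" and f: "solution S l f" and g: "solution S m g"
    and cd: "c \<le> d" "{c..d} \<subseteq> ivl S"
  shows "((\<lambda>x. (l - m) * (f x * g x * cw S x)) has_integral (wronskian S f g d - wronskian S f g c)) {c..d}"
proof -
  define F where "F = pdiff S f"
  define G where "G = pdiff S g"
  have f: "solves_system S l f F" and g: "solves_system S m g G"
    using f g adm by (simp_all add: F_def G_def solution_iff_solves_system)
  have W: "wronskian S f g = (\<lambda>x. 1 * (f x * G x) + (-1) * (F x * g x))"
    by (auto simp: wronskian_def F_def G_def)
  have ac: "abs_cont_on c d (wronskian S f g)"
    unfolding W using f g cd by (intro abs_cont_on_lincomb abs_cont_on_mult) (auto simp: solves_system_def intro: AC_locD)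
  have "AE x in lebesgue_on (ivl S). \<exists>D. (f has_vector_derivative D) (at x) \<and> F x = cp S x *\<^sub>R D"
    "AE x in lebesgue_on (ivl S). (F has_vector_derivative - ((l * cw S x + cq S x) * f x)) (at x)"
    "AE x in lebesgue_on (ivl S). \<exists>D. (g has_vector_derivative D) (at x) \<and> G x = cp S x *\<^sub>R D"
    "AE x in lebesgue_on (ivl S). (G has_vector_derivative - ((m * cw S x + cq S x) * g x)) (at x)"
    using f g by (auto simp: solves_system_def)
  then have "AE x in lebesgue_on (ivl S). (wronskian S f g has_vector_derivative (l - m) * (f x * g x * cw S x)) (at x)"
  proof eventually_elim
    case (elim x)
    then obtain D E where D: "(f has_vector_derivative D) (at x)" "F x = cp S x *\<^sub>R D"
       "(g has_vector_derivative E) (at x)" "G x = cp S x *\<^sub>R E" by blast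
    have "((\<lambda>x. f x * G x - F x * g x) has_vector_derivative
        (f x * (- ((m * cw S x + cq S x) * g x)) + D * G x)
        - (F x * E + (- ((l * cw S x + cq S x) * f x)) * g x)) (at x)"
      using D(1,3) elim(2,4) by (intro has_vector_derivative_diff has_vector_derivative_mult)
    then show ?case
      unfolding W using D(2,4) by (simp add: scaleR_conv_of_real algebra_simps)
  qed
  then have "negligible {x \<in> ivl S. \<not> (wronskian S f g has_vector_derivative (l - m) * (f x * g x * cw S x)) (at x)}"
    by (simp add: AE_lebesgue_on_iff_negligible)
  then show ?thesis
    by (rule abs_cont_on_FTC[OF ac cd(1)])
       (use cd(2) in \<open>auto intro: has_vector_derivative_at_within\<close>)
qed

section \<open>Limits at the endpoints\<close>

lemma ereal_less_trans_left: "a < ereal x \<Longrightarrow> x < y \<Longrightarrow> a < ereal y"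
  using less_trans[of a "ereal x" "ereal y"] by simp

lemma ereal_less_trans_right: "ereal y < b \<Longrightarrow> x < y \<Longrightarrow> ereal x < b"
  using less_trans[of "ereal x" "ereal y" b] by simp

text \<open>Dominated convergence, with the norm of \<open>k\<close> on \<open>N\<close> as the
  majorant.\<close>

lemma tendsto_set_integral_exhaustion:
  fixes k :: "'a \<Rightarrow> 'b::{banach, second_countable_topology}"
  assumes k: "set_integrable M N k" and A: "\<And>n. A n \<in> sets M" and N: "N \<in> sets M"
    and sub: "\<forall>\<^sub>F n in sequentially. A n \<subseteq> N"
    and ev: "\<And>t. t \<in> N \<Longrightarrow> \<forall>\<^sub>F n in sequentially. t \<in> A n"
  shows "(\<lambda>n. LINT t:A n|M. k t) \<longlonglongrightarrow> (LINT t:N|M. k t)"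
proof -
  \<comment> \<open>Early sets \<open>A n\<close> may stick out of \<open>N\<close>, where
    \<open>k\<close> is not controlled; the intersection is harmless in the limit.\<close>
  have "(\<lambda>n. LINT t:A n \<inter> N|M. k t) \<longlonglongrightarrow> (LINT t:N|M. k t)"
    unfolding set_lebesgue_integral_def
  proof (rule integral_dominated_convergence)
    show "integrable M (\<lambda>t. norm (indicator N t *\<^sub>R k t))"
      using k unfolding set_integrable_def by (rule integrable_norm)
    show "(\<lambda>t. indicator N t *\<^sub>R k t) \<in> borel_measurable M"
      using k unfolding set_integrable_def by (rule borel_measurable_integrable)
    show "(\<lambda>t. indicator (A n \<inter> N) t *\<^sub>R k t) \<in> borel_measurable M" for n
    proof -
      have "set_integrable M (A n \<inter> N) k"
        by (rule set_integrable_subset[OF k]) (use A N in auto)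
      then show ?thesis unfolding set_integrable_def by (rule borel_measurable_integrable)
    qed
    show "AE t in M. (\<lambda>n. indicator (A n \<inter> N) t *\<^sub>R k t) \<longlonglongrightarrow> indicator N t *\<^sub>R k t"
    proof (rule AE_I2)
      fix t
      show "(\<lambda>n. indicator (A n \<inter> N) t *\<^sub>R k t) \<longlonglongrightarrow> indicator N t *\<^sub>R k t"
      proof (cases "t \<in> N")
        case True
        have "\<forall>\<^sub>F n in sequentially. indicator (A n \<inter> N) t *\<^sub>R k t = indicator N t *\<^sub>R k t"
          using ev[OF True] by eventually_elim (use True in simp)
        then show ?thesis by (rule tendsto_eventually)
      qed auto
    qed
    show "AE t in M. norm (indicator (A n \<inter> N) t *\<^sub>R k t) \<le> norm (indicator N t *\<^sub>R k t)" for n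
      by (auto simp: indicator_def)
  qed
  moreover have "\<forall>\<^sub>F n in sequentially. (LINT t:A n \<inter> N|M. k t) = (LINT t:A n|M. k t)"
    using sub by eventually_elim (simp add: Int_absorb2)
  ultimately show ?thesis by (rule Lim_transform_eventually)
qed

section \<open>Endpoint filters and one-sided neighbourhoods\<close>

fun end_filter :: "sl_coeffs \<Rightarrow> endpoint \<Rightarrow> ereal filter" where
  "end_filter S LeftEnd = at_right (lend S)"
| "end_filter S RightEnd = at_left (rend S)"

lemma end_lim_eq_Lim: "end_lim S e h = Lim (end_filter S e) (h \<circ> real_of_ereal)"
  by (cases e) auto

lemma end_filter_nontrivial:
  assumes "lend S < rend S"
  shows "end_filter S e \<noteq> bot"
proof (cases e)
  case LeftEnd
  then show ?thesis
    using assms dense by (simp add: trivial_limit_def eventually_at_right[OF assms]) blast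
next
  case RightEnd
  then show ?thesis
    using assms dense by (simp add: trivial_limit_def eventually_at_left[OF assms]) blast
qed

lemma end_limI:
  assumes "lend S < rend S" "((h \<circ> real_of_ereal) \<longlongrightarrow> L) (end_filter S e)"
  shows "end_lim S e h = L"
  unfolding end_lim_eq_Lim by (rule tendsto_Lim[OF end_filter_nontrivial[OF assms(1)] assms(2)])

lemma near_sets_lebesgue [simp]: "near S e c \<in> sets lebesgue"
  by (cases e) (simp_all add: borel_open)

lemma near_subset_ivl:
  assumes "c \<in> ivl S"
  shows "near S e c \<subseteq> ivl S"
  using assms by (cases e) (auto simp: ivl_def einterval_iff intro: ereal_less_trans_left ereal_less_trans_right)

lemma near_mono:
  obtains c where "c = c1 \<or> c = c2" "near S e c \<subseteq> near S e c1" "near S e c \<subseteq> near S e c2"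
proof (cases e)
  case LeftEnd
  show thesis
    by (rule that[of "min c1 c2"])
      (auto simp: LeftEnd einterval_iff min_def not_le intro: ereal_less_trans_left ereal_less_trans_right split: if_splits)
next
  case RightEnd
  show thesis
    by (rule that[of "max c1 c2"])
      (auto simp: RightEnd einterval_iff max_def not_le intro: ereal_less_trans_left ereal_less_trans_right split: if_splits)
qed

text \<open>The weight is only locally integrable, so it is obtained as the pointwise limit of its
  truncations to compact intervals exhausting \<open>ivl S\<close>.\<close>

lemma cw_measurable:
  assumes "admissible S"
  shows "cw S \<in> borel_measurable (lebesgue_on (ivl S))"
proof -
  have "lend S < rend S" using assms by (simp add: admissible_def)
  then obtain u l where ul: "ivl S = (\<Union>i. {l i .. u i})" "incseq u" "decseq l"
    unfolding ivl_def by (rule einterval_Icc_approximation) blast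
  have int: "set_integrable lebesgue {l i..u i} (cw S)" for i
  proof -
    have "{l i..u i} \<subseteq> ivl S" using ul(1) by blast
    then show ?thesis using assms by (simp add: admissible_def locally_L1_def)
  qed
  have "(\<lambda>x. indicator (ivl S) x *\<^sub>R cw S x) \<in> borel_measurable lebesgue"
  proof (rule borel_measurable_LIMSEQ_real)
    show "(\<lambda>x. indicator {l i..u i} x *\<^sub>R cw S x) \<in> borel_measurable lebesgue" for i
      using int[of i] unfolding set_integrable_def by (rule borel_measurable_integrable)
    fix x
    show "(\<lambda>i. indicator {l i..u i} x *\<^sub>R cw S x) \<longlonglongrightarrow> indicator (ivl S) x *\<^sub>R cw S x"
    proof (cases "x \<in> ivl S")
      case True
      then obtain n where "x \<in> {l n..u n}" using ul(1) by blast
      then have "x \<in> {l i..u i}" if "i \<ge> n" for i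
        using incseqD[OF ul(2) that] decseqD[OF ul(3) that] by auto
      then have "\<forall>\<^sub>F i in sequentially. indicator {l i..u i} x *\<^sub>R cw S x = indicator (ivl S) x *\<^sub>R cw S x"
        using True unfolding eventually_sequentially by (intro exI[of _ n]) (simp add: indicator_def)
      then show ?thesis by (rule tendsto_eventually)
    next
      case False
      then have "x \<notin> {l i..u i}" for i using ul(1) by blast
      then show ?thesis using False by (simp add: indicator_def del: atLeastAtMost_iff)
    qed
  qed
  then show ?thesis by (subst borel_measurable_restrict_space_iff) auto
qed

section \<open>Integrability of products of solutions near an endpoint\<close>

lemma solution_continuous_on: "solution S l f \<Longrightarrow> continuous_on (ivl S) f"
  by (auto simp: solution_def AC2_loc_def intro: AC_loc_continuous_on)

lemma solution_measurable: "solution S l f \<Longrightarrow> f \<in> borel_measurable (lebesgue_on (ivl S))"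
  by (intro continuous_imp_measurable_on_sets_lebesgue solution_continuous_on) simp_all

text \<open>Each factor is square integrable with weight near a limit-circle endpoint, and the
  product of the moduli is at most the sum of their squares. The spectral parameters may differ, as
  is needed for pairing an arbitrary solution with a reference solution.\<close>

lemma set_integrable_near_product:
  assumes adm: "admissible S" and lc: "limit_circle S e"
    and f: "solution S l f" and g: "solution S m g"
  obtains c where "c \<in> ivl S" "set_integrable lebesgue (near S e c) (\<lambda>x. f x * g x * cw S x)"
proof -
  obtain c1 where c1: "c1 \<in> ivl S" "set_integrable lebesgue (near S e c1) (\<lambda>x. (cmod (f x))\<^sup>2 * cw S x)"
    using lc f unfolding limit_circle_def integrable_near_def by blast
  obtain c2 where c2: "c2 \<in> ivl S" "set_integrable lebesgue (near S e c2) (\<lambda>x. (cmod (g x))\<^sup>2 * cw S x)"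
    using lc g unfolding limit_circle_def integrable_near_def by blast
  obtain c where c: "c = c1 \<or> c = c2" "near S e c \<subseteq> near S e c1" "near S e c \<subseteq> near S e c2"
    by (rule near_mono)
  let ?N = "near S e c"
  have ci: "c \<in> ivl S" using c(1) c1(1) c2(1) by auto
  have "set_integrable lebesgue ?N (\<lambda>x. (cmod (f x))\<^sup>2 * cw S x)"
    "set_integrable lebesgue ?N (\<lambda>x. (cmod (g x))\<^sup>2 * cw S x)"
    using set_integrable_subset[OF c1(2) _ c(2)] set_integrable_subset[OF c2(2) _ c(3)] by simp_all
  \<comment> \<open>Norms in the majorant make the bound valid at every point, although
    \<open>cw S\<close> is positive only almost everywhere.\<close>
  then have "integrable (lebesgue_on ?N) (\<lambda>x. norm ((cmod (f x))\<^sup>2 * cw S x) + norm ((cmod (g x))\<^sup>2 * cw S x))"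
    by (subst (asm) (1 2) set_integrable_eq) (auto intro: integrable_add integrable_norm)
  moreover have "(\<lambda>x. f x * g x * cw S x) \<in> borel_measurable (lebesgue_on ?N)"
  proof -
    have "(\<lambda>x. f x * g x * cw S x) \<in> borel_measurable (lebesgue_on (ivl S))"
      using solution_measurable[OF f] solution_measurable[OF g] cw_measurable[OF adm] by measurable
    then show ?thesis
      using near_subset_ivl[OF ci] measurable_restrict_mono by blast
  qed
  moreover have "norm (f x * g x * cw S x) \<le> norm (norm ((cmod (f x))\<^sup>2 * cw S x) + norm ((cmod (g x))\<^sup>2 * cw S x))" for x
  proof -
    have "cmod (f x) * cmod (g x) \<le> (cmod (f x))\<^sup>2 + (cmod (g x))\<^sup>2"
      using sum_squares_bound[of "cmod (f x)" "cmod (g x)"]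
        mult_nonneg_nonneg[OF norm_ge_zero[of "f x"] norm_ge_zero[of "g x"]]
      by linarith
    then have "cmod (f x) * cmod (g x) * \<bar>cw S x\<bar> \<le> ((cmod (f x))\<^sup>2 + (cmod (g x))\<^sup>2) * \<bar>cw S x\<bar>"
      by (rule mult_right_mono) simp
    then show ?thesis by (simp add: norm_mult abs_mult distrib_right)
  qed
  ultimately have "integrable (lebesgue_on ?N) (\<lambda>x. f x * g x * cw S x)"
    by (auto intro: Bochner_Integration.integrable_bound)
  then have "set_integrable lebesgue ?N (\<lambda>x. f x * g x * cw S x)"
    by (subst set_integrable_eq) auto
  with ci show thesis by (rule that)
qed

text \<open>\<open>F x\<close> equals \<open>F c\<close> minus the integral of \<open>k\<close> over
  \<open>{x..c}\<close>, and these integrals converge because \<open>k\<close> is integrable up to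
  the endpoint, finite or infinite.\<close>

lemma tendsto_left_end:
  fixes F :: "real \<Rightarrow> complex"
  assumes c: "c \<in> ivl S" and k: "set_integrable lebesgue (einterval (lend S) (ereal c)) k"
    and F: "\<And>x. x \<in> ivl S \<Longrightarrow> x \<le> c \<Longrightarrow> (k has_integral (F c - F x)) {x..c}"
  shows "((F \<circ> real_of_ereal) \<longlongrightarrow> F c - (LINT t:einterval (lend S) (ereal c)|lebesgue. k t)) (at_right (lend S))"
  unfolding tendsto_at_iff_sequentially
proof (intro allI impI)
  let ?N = "einterval (lend S) (ereal c)"
  fix X :: "nat \<Rightarrow> ereal" assume X: "\<forall>i. X i \<in> {lend S<..} - {lend S}" and lim: "X \<longlonglongrightarrow> lend S"
  define x where "x i = real_of_ereal (X i)" for i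
  have lc: "lend S < ereal c" "ereal c < rend S" using c by (auto simp: ivl_def einterval_iff)
  have ev: "\<forall>\<^sub>F n in sequentially. X n < ereal c"
    using lim lc(1) by (rule order_tendstoD(2))
  \<comment> \<open>Below \<open>c\<close> and above the left endpoint the extended real
    \<open>X n\<close> is finite, so \<open>real_of_ereal\<close> loses nothing.\<close>
  have xX: "ereal (x n) = X n" if "X n < ereal c" for n
    unfolding x_def using X[rule_format, of n] that by (cases "X n") auto
  have "(\<lambda>n. LINT t:{x n<..<c}|lebesgue. k t) \<longlonglongrightarrow> (LINT t:?N|lebesgue. k t)"
  proof (rule tendsto_set_integral_exhaustion[OF k])
    show "\<forall>\<^sub>F n in sequentially. {x n<..<c} \<subseteq> ?N"
      using ev
    proof eventually_elim
      case (elim n)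
      have "lend S < ereal (x n)" using X[rule_format, of n] xX[OF elim] by auto
      then show ?case by (auto simp: einterval_iff intro: ereal_less_trans_left ereal_less_trans_right)
    qed
    fix t assume "t \<in> ?N"
    then have t: "lend S < ereal t" "t < c" by (auto simp: einterval_iff)
    have "\<forall>\<^sub>F n in sequentially. X n < ereal t"
      using lim t(1) by (rule order_tendstoD(2))
    then show "\<forall>\<^sub>F n in sequentially. t \<in> {x n<..<c}"
      using ev
    proof eventually_elim
      case (elim n)
      then have "ereal (x n) < ereal t" using xX by simp
      then show ?case using t by simp
    qed
  qed (auto simp: borel_open)
  then have "(\<lambda>n. F c - (LINT t:{x n<..<c}|lebesgue. k t)) \<longlonglongrightarrow> F c - (LINT t:?N|lebesgue. k t)"
    by (intro tendsto_intros)
  moreover have "\<forall>\<^sub>F n in sequentially. F c - (LINT t:{x n<..<c}|lebesgue. k t) = (F \<circ> real_of_ereal \<circ> X) n"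
    using ev
  proof eventually_elim
    case (elim n)
    have l: "lend S < ereal (x n)" "x n < c" using X[rule_format, of n] xX[OF elim] elim
      by (auto simp flip: less_ereal.simps(1))
    then have "x n \<in> ivl S" using lc by (auto simp: ivl_def einterval_iff intro: ereal_less_trans_left ereal_less_trans_right)
    \<comment> \<open>The gauge integral supplies the value and absolute integrability identifies it
      with the Lebesgue integral; passing to the open interval does not change it.\<close>
    then have "(k has_integral (F c - F (x n))) {x n<..<c}"
      using F[of "x n"] l by (simp add: has_integral_Icc_iff_Ioo)
    moreover have "set_integrable lebesgue {x n<..<c} k"
      by (rule set_integrable_subset[OF k])
        (use l in \<open>auto simp: einterval_iff borel_open intro: ereal_less_trans_left ereal_less_trans_right\<close>)
    ultimately have "(LINT t:{x n<..<c}|lebesgue. k t) = F c - F (x n)"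
      using set_lebesgue_integral_eq_integral(2) integral_unique by metis
    then show ?case by (simp add: x_def)
  qed
  ultimately show "(F \<circ> real_of_ereal \<circ> X) \<longlonglongrightarrow> F c - (LINT t:?N|lebesgue. k t)"
    by (rule Lim_transform_eventually)
qed

lemma tendsto_right_end:
  fixes F :: "real \<Rightarrow> complex"
  assumes c: "c \<in> ivl S" and k: "set_integrable lebesgue (einterval (ereal c) (rend S)) k"
    and F: "\<And>x. x \<in> ivl S \<Longrightarrow> c \<le> x \<Longrightarrow> (k has_integral (F x - F c)) {c..x}"
  shows "((F \<circ> real_of_ereal) \<longlongrightarrow> F c + (LINT t:einterval (ereal c) (rend S)|lebesgue. k t)) (at_left (rend S))"
  unfolding tendsto_at_iff_sequentially
proof (intro allI impI)
  let ?N = "einterval (ereal c) (rend S)"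
  fix X :: "nat \<Rightarrow> ereal" assume X: "\<forall>i. X i \<in> {..<rend S} - {rend S}" and lim: "X \<longlonglongrightarrow> rend S"
  define x where "x i = real_of_ereal (X i)" for i
  have lc: "lend S < ereal c" "ereal c < rend S" using c by (auto simp: ivl_def einterval_iff)
  have ev: "\<forall>\<^sub>F n in sequentially. ereal c < X n"
    using lim lc(2) by (rule order_tendstoD(1))
  have xX: "ereal (x n) = X n" if "ereal c < X n" for n
    unfolding x_def using X[rule_format, of n] that by (cases "X n") auto
  have "(\<lambda>n. LINT t:{c<..<x n}|lebesgue. k t) \<longlonglongrightarrow> (LINT t:?N|lebesgue. k t)"
  proof (rule tendsto_set_integral_exhaustion[OF k])
    show "\<forall>\<^sub>F n in sequentially. {c<..<x n} \<subseteq> ?N"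
      using ev
    proof eventually_elim
      case (elim n)
      have "ereal (x n) < rend S" using X[rule_format, of n] xX[OF elim] by auto
      then show ?case by (auto simp: einterval_iff intro: ereal_less_trans_left ereal_less_trans_right)
    qed
    fix t assume "t \<in> ?N"
    then have t: "ereal t < rend S" "c < t" by (auto simp: einterval_iff)
    have "\<forall>\<^sub>F n in sequentially. ereal t < X n"
      using lim t(1) by (rule order_tendstoD(1))
    then show "\<forall>\<^sub>F n in sequentially. t \<in> {c<..<x n}"
      using ev
    proof eventually_elim
      case (elim n)
      then have "ereal t < ereal (x n)" using xX by simp
      then show ?case using t by simp
    qed
  qed (auto simp: borel_open)
  then have "(\<lambda>n. F c + (LINT t:{c<..<x n}|lebesgue. k t)) \<longlonglongrightarrow> F c + (LINT t:?N|lebesgue. k t)"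
    by (intro tendsto_intros)
  moreover have "\<forall>\<^sub>F n in sequentially. F c + (LINT t:{c<..<x n}|lebesgue. k t) = (F \<circ> real_of_ereal \<circ> X) n"
    using ev
  proof eventually_elim
    case (elim n)
    have l: "ereal (x n) < rend S" "c < x n" using X[rule_format, of n] xX[OF elim] elim
      by (auto simp flip: less_ereal.simps(1))
    then have "x n \<in> ivl S" using lc by (auto simp: ivl_def einterval_iff intro: ereal_less_trans_left ereal_less_trans_right)
    then have "(k has_integral (F (x n) - F c)) {c<..<x n}"
      using F[of "x n"] l by (simp add: has_integral_Icc_iff_Ioo)
    moreover have "set_integrable lebesgue {c<..<x n} k"
      by (rule set_integrable_subset[OF k])
        (use l in \<open>auto simp: einterval_iff borel_open intro: ereal_less_trans_left ereal_less_trans_right\<close>)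
    ultimately have "(LINT t:{c<..<x n}|lebesgue. k t) = F (x n) - F c"
      using set_lebesgue_integral_eq_integral(2) integral_unique by metis
    then show ?case by (simp add: x_def)
  qed
  ultimately show "(F \<circ> real_of_ereal \<circ> X) \<longlonglongrightarrow> F c + (LINT t:?N|lebesgue. k t)"
    by (rule Lim_transform_eventually)
qed

text \<open>\<open>end_lim\<close> is defined by \<open>Lim\<close>, which is informative only if
  the limit exists; the Lagrange identity with an integrable right-hand side ensures this.\<close>

lemma wronskian_tendsto_end:
  assumes adm: "admissible S" and lc: "limit_circle S e"
    and f: "solution S l f" and g: "solution S m g"
  shows "((wronskian S f g \<circ> real_of_ereal) \<longlongrightarrow> end_lim S e (wronskian S f g)) (end_filter S e)"
proof -
  let ?k = "\<lambda>x. (l - m) * (f x * g x * cw S x)"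
  obtain c where c: "c \<in> ivl S" "set_integrable lebesgue (near S e c) (\<lambda>x. f x * g x * cw S x)"
    using set_integrable_near_product[OF assms] .
  then have k: "set_integrable lebesgue (near S e c) ?k" by simp
  note int = wronskian_has_integral[OF adm f g]
  have "\<exists>L. ((wronskian S f g \<circ> real_of_ereal) \<longlongrightarrow> L) (end_filter S e)"
  proof (cases e)
    case LeftEnd
    then show ?thesis
      using tendsto_left_end[OF c(1), of ?k "wronskian S f g"] k c(1) int Icc_subset_ivl by auto
  next
    case RightEnd
    then show ?thesis
      using tendsto_right_end[OF c(1), of ?k "wronskian S f g"] k c(1) int Icc_subset_ivl by auto
  qed
  then obtain L where L: "((wronskian S f g \<circ> real_of_ereal) \<longlongrightarrow> L) (end_filter S e)" ..
  moreover have "lend S < rend S" using adm by (simp add: admissible_def)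
  ultimately show ?thesis using end_limI by metis
qed

text \<open>Square integrability comes from the limit-circle condition near both ends and from
  boundedness on the compact middle part; \<open>ell S f\<close> inherits it because it is
  \<open>l * f\<close> almost everywhere.\<close>

lemma solution_in_Dmax:
  assumes adm: "admissible S" and lc: "\<And>e. limit_circle S e" and f: "solution S l f"
  shows "f \<in> Dmax S"
proof -
  let ?h = "\<lambda>x. (cmod (f x))\<^sup>2 * cw S x"
  obtain a where a: "a \<in> ivl S" "set_integrable lebesgue (near S LeftEnd a) ?h"
    using lc[of LeftEnd] f unfolding limit_circle_def integrable_near_def by blast
  obtain b where b: "b \<in> ivl S" "set_integrable lebesgue (near S RightEnd b) ?h"
    using lc[of RightEnd] f unfolding limit_circle_def integrable_near_def by blast
  \<comment> \<open>No order between \<open>a\<close> and \<open>b\<close> is assumed: if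
    \<open>b < a\<close>, the middle interval is empty and the two neighbourhoods already cover
    \<open>ivl S\<close>.\<close>
  have sub: "{a..b} \<subseteq> ivl S" using a(1) b(1) by (rule Icc_subset_ivl)
  have f_meas: "f \<in> borel_measurable (lebesgue_on (ivl S))" using f by (rule solution_measurable)
  have mid: "set_integrable lebesgue {a..b} ?h"
  proof -
    have "compact (f ` {a..b})"
      using continuous_on_subset[OF solution_continuous_on[OF f] sub] compact_Icc
      by (rule compact_continuous_image)
    then have "bounded (f ` {a..b})" by (rule compact_imp_bounded)
    then obtain M where "\<forall>y\<in>f ` {a..b}. cmod y \<le> M" unfolding bounded_iff by blast
    then have M: "cmod (f x) \<le> M" if "x \<in> {a..b}" for x using that by blast
    have w: "set_integrable lebesgue {a..b} (\<lambda>x. M\<^sup>2 * cw S x)"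
      using adm sub by (intro set_integrable_mult_right) (simp add: admissible_def locally_L1_def)
    show ?thesis
    proof (rule set_integrable_bound[OF w])
      have "?h \<in> borel_measurable (lebesgue_on (ivl S))"
        using f_meas cw_measurable[OF adm] by measurable
      then have "?h \<in> borel_measurable (lebesgue_on {a..b})"
        using sub measurable_restrict_mono by blast
      then show "set_borel_measurable lebesgue {a..b} ?h"
        unfolding set_borel_measurable_def by (subst (asm) borel_measurable_restrict_space_iff) auto
      have "norm (?h x) \<le> norm (M\<^sup>2 * cw S x)" if "x \<in> {a..b}" for x
        using M[OF that] by (simp add: abs_mult mult_right_mono power_mono)
      then show "AE x in lebesgue. x \<in> {a..b} \<longrightarrow> norm (?h x) \<le> norm (M\<^sup>2 * cw S x)" by simp
    qed
  qed
  have "set_integrable lebesgue (near S LeftEnd a \<union> {a..b} \<union> near S RightEnd b) ?h"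
    using a(2) mid b(2) by (intro set_integrable_Un) simp_all
  then have "set_integrable lebesgue (ivl S) ?h"
  proof (rule set_integrable_subset)
    show "ivl S \<subseteq> near S LeftEnd a \<union> {a..b} \<union> near S RightEnd b"
      by (auto simp: ivl_def einterval_iff)
  qed simp
  then have h: "integrable (lebesgue_on (ivl S)) ?h"
    by (subst (asm) set_integrable_eq) auto
  then have "f \<in> L2w S" using f_meas by (simp add: L2w_def)
  have ae: "AE x in lebesgue_on (ivl S). ell S f x = l * f x" using f by (simp add: solution_def)
  \<comment> \<open>\<open>ell S f\<close> contains a derivative and \<open>cq S\<close>, so its
    measurability is transferred from \<open>l * f\<close>, from which it differs only on the null
    set \<open>?Z\<close>.\<close>
  have ell_meas: "ell S f \<in> borel_measurable (lebesgue_on (ivl S))"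
  proof -
    let ?Z = "{x \<in> ivl S. \<not> ell S f x = l * f x}"
    have "negligible ?Z" using ae by (simp add: AE_lebesgue_on_iff_negligible)
    then have Z: "?Z \<in> null_sets (lebesgue_on (ivl S))"
      by (subst null_sets_restrict_space) (auto simp: negligible_iff_null_sets)
    have "(\<lambda>x. l * f x) \<in> borel_measurable (lebesgue_on (ivl S))" using f_meas by measurable
    then have "(\<lambda>x. l * f x) \<in> borel_measurable (lebesgue_on (ivl S - ?Z))"
      by (rule borel_measurable_diff_null[OF Z ivl_sets_lebesgue, THEN iffD2])
    then have "ell S f \<in> borel_measurable (lebesgue_on (ivl S - ?Z))"
      by (rule measurable_cong[THEN iffD1, rotated]) auto
    then show ?thesis by (rule borel_measurable_diff_null[OF Z ivl_sets_lebesgue, THEN iffD1])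
  qed
  have "integrable (lebesgue_on (ivl S)) (\<lambda>x. (cmod (ell S f x))\<^sup>2 * cw S x)"
  proof (rule integrable_cong_AE_imp)
    show "integrable (lebesgue_on (ivl S)) (\<lambda>x. (cmod l)\<^sup>2 * ?h x)"
      using h by (rule integrable_mult_right)
    show "(\<lambda>x. (cmod (ell S f x))\<^sup>2 * cw S x) \<in> borel_measurable (lebesgue_on (ivl S))"
      using ell_meas cw_measurable[OF adm] by measurable
    show "AE x in lebesgue_on (ivl S). (cmod l)\<^sup>2 * ?h x = (cmod (ell S f x))\<^sup>2 * cw S x"
      using ae by eventually_elim (simp add: norm_mult power_mult_distrib)
  qed
  then have "ell S f \<in> L2w S" using ell_meas by (simp add: L2w_def)
  with \<open>f \<in> L2w S\<close> f show ?thesis by (simp add: Dmax_def solution_def)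
qed

section \<open>Boundary values and eigenspaces\<close>

lemma eventually_end_filter_ivl:
  assumes "lend S < rend S"
  shows "\<forall>\<^sub>F y in end_filter S e. real_of_ereal y \<in> ivl S"
proof -
  have *: "real_of_ereal y \<in> ivl S" if "lend S < y" "y < rend S" for y
    using that by (cases y) (auto simp: ivl_def einterval_iff)
  show ?thesis
  proof (cases e)
    case LeftEnd
    then show ?thesis
      using * assms by (auto simp: eventually_at_right[OF assms])
  next
    case RightEnd
    then show ?thesis
      using * assms by (auto simp: eventually_at_left[OF assms])
  qed
qed

text \<open>For equal spectral parameters the integrand of the Lagrange identity vanishes.\<close>

lemma wronskian_const:
  assumes adm: "admissible S" and "solution S l f" "solution S l g" and "c \<in> ivl S" "d \<in> ivl S"
  shows "wronskian S f g c = wronskian S f g d"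
proof -
  have *: "wronskian S f g c = wronskian S f g d" if "c \<le> d" "c \<in> ivl S" "d \<in> ivl S" for c d
  proof -
    have "((\<lambda>x. 0) has_integral (wronskian S f g d - wronskian S f g c)) {c..d}"
      using wronskian_has_integral[OF adm assms(2,3) that(1) Icc_subset_ivl[OF that(2,3)]] by simp
    then have "wronskian S f g d - wronskian S f g c = 0"
      by (rule has_integral_unique) (rule has_integral_0)
    then show ?thesis by simp
  qed
  show ?thesis using *[OF _ assms(4,5)] *[OF _ assms(5,4), symmetric] linear by blast
qed

section \<open>Boundary values as endpoint limits of Wronskians\<close>

lemma bracket_at_real_solution:
  assumes "admissible S" "solution S (of_real l0) (cplx r)"
  shows "bracket_at S e f (cplx r) = end_lim S e (wronskian S f (cplx r))"
  unfolding bracket_at_def bracket_real_solution[OF assms] ..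

lemma bracket_at_lincomb:
  assumes adm: "admissible S" and lc: "limit_circle S e"
    and f: "solution S l f" and g: "solution S l g" and r: "solution S (of_real l0) (cplx r)"
  shows "bracket_at S e (\<lambda>x. \<alpha> * f x + \<beta> * g x) (cplx r)
       = \<alpha> * bracket_at S e f (cplx r) + \<beta> * bracket_at S e g (cplx r)"
proof -
  have W: "wronskian S (\<lambda>x. \<alpha> * f x + \<beta> * g x) (cplx r) \<circ> real_of_ereal
     = (\<lambda>y. \<alpha> * (wronskian S f (cplx r) \<circ> real_of_ereal) y + \<beta> * (wronskian S g (cplx r) \<circ> real_of_ereal) y)"
    by (simp add: wronskian_def solution_lincomb(2)[OF adm f g] fun_eq_iff algebra_simps)
  have "lend S < rend S" using adm by (simp add: admissible_def)
  then have "end_lim S e (wronskian S (\<lambda>x. \<alpha> * f x + \<beta> * g x) (cplx r))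
      = \<alpha> * end_lim S e (wronskian S f (cplx r)) + \<beta> * end_lim S e (wronskian S g (cplx r))"
    by (rule end_limI)
       (unfold W, intro tendsto_intros wronskian_tendsto_end[OF adm lc f r] wronskian_tendsto_end[OF adm lc g r])
  then show ?thesis by (simp add: bracket_at_real_solution[OF adm r])
qed

text \<open>Expresses the Wronskian by the boundary values via the Pluecker relation
  \<open>W(f,g) W(u,v) = W(f,u) W(g,v) - W(f,v) W(g,u)\<close>, where \<open>W(u,v)\<close> tends to \<open>1\<close> at the endpoint.\<close>

lemma wronskian_eq_quasi:
  assumes adm: "admissible S" and lc: "limit_circle S e"
    and f: "solution S l f" and g: "solution S l g"
    and ref: "reference_system S l0 u v" and x: "x \<in> ivl S"
  shows "wronskian S f g x = quasi0 S v f e * quasi1 S u g e - quasi1 S u f e * quasi0 S v g e"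
proof -
  have u: "solution S (of_real l0) (cplx (u e))" and v: "solution S (of_real l0) (cplx (v e))"
    and uv: "bracket_at S e (cplx (u e)) (cplx (v e)) = 1"
    using ref by (auto simp: reference_system_def principal_def nonprincipal_def)
  let ?W = "\<lambda>f g y. wronskian S f g (real_of_ereal y)"
  let ?U = "cplx (u e)" and ?V = "cplx (v e)"
  have lr: "lend S < rend S" using adm by (simp add: admissible_def)
  have lim: "(?W h k \<longlongrightarrow> end_lim S e (wronskian S h k)) (end_filter S e)"
    if "solution S m h" "solution S m' k" for h k m m'
    using wronskian_tendsto_end[OF adm lc that] by (simp add: o_def)
  have "(?W ?U ?V \<longlongrightarrow> 1) (end_filter S e)"
    using lim[OF u v] uv by (simp add: bracket_at_real_solution[OF adm v])
  \<comment> \<open>The constant value of the Wronskian is multiplied by a factor tending to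
    \<open>1\<close>, so that the Pluecker relation applies at each \<open>y\<close> near the
    endpoint before the limit is taken.\<close>
  then have "((\<lambda>y. wronskian S f g x * ?W ?U ?V y) \<longlongrightarrow> wronskian S f g x * 1) (end_filter S e)"
    by (intro tendsto_intros)
  moreover have "\<forall>\<^sub>F y in end_filter S e. wronskian S f g x * ?W ?U ?V y = ?W f ?U y * ?W g ?V y - ?W f ?V y * ?W g ?U y"
    using eventually_end_filter_ivl[OF lr]
  proof eventually_elim
    case (elim y)
    then have "wronskian S f g x = ?W f g y" by (rule wronskian_const[OF adm f g x])
    moreover have "?W f g y * ?W ?U ?V y = ?W f ?U y * ?W g ?V y - ?W f ?V y * ?W g ?U y"
      by (simp add: wronskian_def algebra_simps)
    ultimately show ?case by simp
  qed
  ultimately have "((\<lambda>y. ?W f ?U y * ?W g ?V y - ?W f ?V y * ?W g ?U y) \<longlongrightarrow> wronskian S f g x * 1) (end_filter S e)"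
    by (rule Lim_transform_eventually)
  moreover have "((\<lambda>y. ?W f ?U y * ?W g ?V y - ?W f ?V y * ?W g ?U y) \<longlongrightarrow>
      end_lim S e (wronskian S f ?U) * end_lim S e (wronskian S g ?V)
      - end_lim S e (wronskian S f ?V) * end_lim S e (wronskian S g ?U)) (end_filter S e)"
    by (intro tendsto_intros lim[OF f u] lim[OF f v] lim[OF g u] lim[OF g v])
  ultimately have "wronskian S f g x * 1 =
      end_lim S e (wronskian S f ?U) * end_lim S e (wronskian S g ?V)
      - end_lim S e (wronskian S f ?V) * end_lim S e (wronskian S g ?U)"
    by (rule tendsto_unique[OF end_filter_nontrivial[OF lr]])
  then show ?thesis
    unfolding quasi0_def quasi1_def bracket_at_real_solution[OF adm u] bracket_at_real_solution[OF adm v]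
    by (simp add: algebra_simps)
qed

lemma quasi_lincomb:
  assumes adm: "admissible S" and lc: "limit_circle S e"
    and f: "solution S l f" and g: "solution S l g" and ref: "reference_system S l0 u v"
  shows "quasi0 S v (\<lambda>x. \<alpha> * f x + \<beta> * g x) e = \<alpha> * quasi0 S v f e + \<beta> * quasi0 S v g e"
    and "quasi1 S u (\<lambda>x. \<alpha> * f x + \<beta> * g x) e = \<alpha> * quasi1 S u f e + \<beta> * quasi1 S u g e"
proof -
  have u: "solution S (of_real l0) (cplx (u e))" and v: "solution S (of_real l0) (cplx (v e))"
    using ref by (auto simp: reference_system_def principal_def nonprincipal_def)
  show "quasi0 S v (\<lambda>x. \<alpha> * f x + \<beta> * g x) e = \<alpha> * quasi0 S v f e + \<beta> * quasi0 S v g e"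
    using bracket_at_lincomb[OF adm lc f g v] by (simp add: quasi0_def)
  show "quasi1 S u (\<lambda>x. \<alpha> * f x + \<beta> * g x) e = \<alpha> * quasi1 S u f e + \<beta> * quasi1 S u g e"
    using bracket_at_lincomb[OF adm lc f g u] by (simp add: quasi1_def)
qed

text \<open>The uniqueness clause of \<open>resolvent_set\<close>, applied to the right-hand side
  zero, excludes nonzero eigenfunctions of \<open>L_infinity S u\<close>.\<close>

lemma resolvent_L_infinity_kernel:
  assumes adm: "admissible S" and lc: "\<And>e. limit_circle S e" and ref: "reference_system S l0 u v"
    and l: "l \<in> resolvent_set S (L_infinity S u)"
    and f: "solution S l f" and q: "\<And>e. quasi1 S u f e = 0"
  shows "f = (\<lambda>x. 0)"
proof -
  have zero: "(\<lambda>x. 0) \<in> L2w S" by (simp add: L2w_def)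
  have "\<forall>g\<in>L2w S. \<exists>!f. f \<in> fst (L_infinity S u) \<and>
      (AE x in lebesgue_on (ivl S). snd (L_infinity S u) f x - l * f x = g x)"
    using l by (simp add: resolvent_set_def)
  then have ex1: "\<exists>!f. f \<in> fst (L_infinity S u) \<and>
      (AE x in lebesgue_on (ivl S). snd (L_infinity S u) f x - l * f x = 0)"
    by (rule bspec[OF _ zero])
  have mem: "g \<in> fst (L_infinity S u) \<and> (AE x in lebesgue_on (ivl S). snd (L_infinity S u) g x - l * g x = 0)"
    if "solution S l g" "\<And>e. quasi1 S u g e = 0" for g
    using that solution_in_Dmax[OF adm lc that(1)]
    by (simp add: L_infinity_def restrict_op_def Lmax_def solution_def)
  \<comment> \<open>Both \<open>f\<close> and twice \<open>f\<close> solve the same homogeneous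
    problem, so uniqueness makes them equal. The term with coefficient \<open>0\<close> fits the
    shape of the linear combination lemmas.\<close>
  have "quasi1 S u (\<lambda>x. 2 * f x + 0 * f x) e = 0" for e
    using quasi_lincomb(2)[OF adm lc f f ref, where \<alpha> = 2 and \<beta> = 0] q by simp
  then have "f = (\<lambda>x. 2 * f x + 0 * f x)"
    using ex1 mem[OF f q] mem[OF solution_lincomb(1)[OF adm f f, of 2 0]] by blast
  then have "f x = 2 * f x + 0 * f x" for x by (rule fun_cong)
  then show ?thesis by (auto simp: fun_eq_iff)
qed

text \<open>At limit-circle endpoints every solution lies in \<open>Dmax S\<close>, so only the
  boundary condition remains, written out row by row. The minus signs stem from the first component
  of \<open>Gamma0\<close>.\<close>

lemma mem_eigenspace_L_ext:
  assumes adm: "admissible S" and lc: "\<And>e. limit_circle S e"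
  shows "f \<in> eigenspace S (L_ext S u v T) l \<longleftrightarrow> solution S l f \<and>
     - T $ 1 $ 1 * quasi1 S u f LeftEnd + T $ 1 $ 2 * quasi1 S u f RightEnd = quasi0 S v f LeftEnd \<and>
     - T $ 2 $ 1 * quasi1 S u f LeftEnd + T $ 2 $ 2 * quasi1 S u f RightEnd = quasi0 S v f RightEnd"
proof -
  have "T *v Gamma0 S u f = Gamma1 S v f \<longleftrightarrow>
     - T $ 1 $ 1 * quasi1 S u f LeftEnd + T $ 1 $ 2 * quasi1 S u f RightEnd = quasi0 S v f LeftEnd \<and>
     - T $ 2 $ 1 * quasi1 S u f LeftEnd + T $ 2 $ 2 * quasi1 S u f RightEnd = quasi0 S v f RightEnd"
    by (simp add: vec_eq_iff forall_2 matrix_vector_mult_def sum_2 Gamma0_def Gamma1_def)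
  moreover have "f \<in> eigenspace S (L_ext S u v T) l \<longleftrightarrow> solution S l f \<and> T *v Gamma0 S u f = Gamma1 S v f"
    using solution_in_Dmax[OF adm lc, of l f]
    by (auto simp: eigenspace_def L_ext_def restrict_op_def Lmax_def solution_def Dmax_def)
  ultimately show ?thesis by simp
qed

text \<open>For \<^term>\<open>l\<close> in the resolvent set of \<^term>\<open>L_infinity S u\<close> the boundary map \<^term>\<open>Gamma0 S u\<close> is
  injective on the solutions, so a two-dimensional space of solutions already contains them all.\<close>

lemma solution_in_eigenspace_L_ext:
  assumes adm: "admissible S" and lc: "\<And>e. limit_circle S e" and ref: "reference_system S l0 u v"
    and l: "l \<in> resolvent_set S (L_infinity S u)"
    and dim: "ev_multiplicity S (L_ext S u v T) l = 2"
    and g: "solution S l g"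
  shows "g \<in> eigenspace S (L_ext S u v T) l"
proof -
  let ?E = "eigenspace S (L_ext S u v T) l"
  note E = mem_eigenspace_L_ext[OF adm lc, where u = u and v = v and l = l]
  obtain Bs where Bs: "Bs \<subseteq> ?E" "cfun.independent Bs" "card Bs = 2"
    using cfun.basis_exists[of ?E] dim unfolding ev_multiplicity_def by metis
  then obtain f h where fh: "Bs = {f, h}" "f \<noteq> h" by (auto simp: card_2_iff)
  have indep: "\<alpha> = 0 \<and> \<beta> = 0" if "(\<lambda>x. \<alpha> * f x + \<beta> * h x) = (\<lambda>x. 0)" for \<alpha> \<beta>
  proof -
    \<comment> \<open>The coefficients are well defined as a function on the basis because
      \<open>f\<close> and \<open>h\<close> are distinct.\<close>
    let ?c = "\<lambda>k. if k = f then \<alpha> else \<beta>"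
    have "(\<Sum>k\<in>{f, h}. (\<lambda>x. ?c k * k x)) = 0"
      using that fh(2) by (simp add: plus_fun_def zero_fun_def)
    then have "?c k = 0" if "k \<in> {f, h}" for k
      using cfun.independentD[OF Bs(2)[unfolded fh(1)], of "{f, h}" ?c k] that by simp
    then show ?thesis using fh(2) by force
  qed
  have f: "solution S l f" and h: "solution S l h" using Bs fh E by auto
  note kernel = resolvent_L_infinity_kernel[OF adm lc ref l]
  note lin = quasi_lincomb(2)[OF adm lc _ _ ref]
  define fa fb ha hb where q: "fa = quasi1 S u f LeftEnd" "fb = quasi1 S u f RightEnd"
     "ha = quasi1 S u h LeftEnd" "hb = quasi1 S u h RightEnd"
  have coeff: "\<alpha> = 0 \<and> \<beta> = 0" if "\<alpha> * fa + \<beta> * ha = 0" "\<alpha> * fb + \<beta> * hb = 0" for \<alpha> \<beta>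
  proof (rule indep, rule kernel)
    show "solution S l (\<lambda>x. \<alpha> * f x + \<beta> * h x)" by (rule solution_lincomb(1)[OF adm f h])
    show "quasi1 S u (\<lambda>x. \<alpha> * f x + \<beta> * h x) e = 0" for e
      using lin[OF f h, where \<alpha> = \<alpha> and \<beta> = \<beta>] that by (cases e) (simp_all add: q)
  qed
  \<comment> \<open>If the determinant vanished, \<open>(ha, - fa)\<close> and
    \<open>(hb, - fb)\<close> would be relations between the boundary vectors. Injectivity makes all
    entries zero, and then the coefficients \<open>(1, 0)\<close> give a contradiction.\<close>
  have D: "fa * hb - fb * ha \<noteq> 0"
  proof
    assume D0: "fa * hb - fb * ha = 0"
    have "ha = 0 \<and> - fa = 0" by (rule coeff) (use D0 in \<open>simp_all add: algebra_simps\<close>)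
    moreover have "hb = 0 \<and> - fb = 0" by (rule coeff) (use D0 in \<open>simp_all add: algebra_simps\<close>)
    ultimately show False using coeff[of 1 0] by simp
  qed
  define ga gb where g_def: "ga = quasi1 S u g LeftEnd" "gb = quasi1 S u g RightEnd"
  \<comment> \<open>Cramer's rule: the combination of \<open>f\<close> and \<open>h\<close> with the
    same first quasi-derivatives as \<open>g\<close> at both ends.\<close>
  define \<alpha> \<beta> where ab: "\<alpha> = (ga * hb - gb * ha) / (fa * hb - fb * ha)" "\<beta> = (fa * gb - fb * ga) / (fa * hb - fb * ha)"
  have sa: "\<alpha> * fa + \<beta> * ha = ga"
  proof -
    have "\<alpha> * fa + \<beta> * ha = (ga * (fa * hb - fb * ha)) / (fa * hb - fb * ha)"
      unfolding ab by (simp add: add_divide_distrib[symmetric] algebra_simps)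
    then show ?thesis using D by simp
  qed
  have sb: "\<alpha> * fb + \<beta> * hb = gb"
  proof -
    have "\<alpha> * fb + \<beta> * hb = (gb * (fa * hb - fb * ha)) / (fa * hb - fb * ha)"
      unfolding ab by (simp add: add_divide_distrib[symmetric] algebra_simps)
    then show ?thesis using D by simp
  qed
  let ?k = "\<lambda>x. \<alpha> * f x + \<beta> * h x"
  have k: "solution S l ?k" by (rule solution_lincomb(1)[OF adm f h])
  \<comment> \<open>The difference is a solution whose first quasi-derivatives vanish at both
    endpoints, hence zero.\<close>
  have "(\<lambda>x. 1 * g x + (-1) * ?k x) = (\<lambda>x. 0)"
  proof (rule kernel)
    show "solution S l (\<lambda>x. 1 * g x + (-1) * ?k x)" by (rule solution_lincomb(1)[OF adm g k])
    show "quasi1 S u (\<lambda>x. 1 * g x + (-1) * ?k x) e = 0" for e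
      unfolding lin[OF g k] lin[OF f h] using sa sb by (cases e) (simp_all add: q g_def)
  qed
  then have gk: "g = ?k" by (simp add: fun_eq_iff algebra_simps)
  have "?k \<in> ?E"
    using k Bs(1) fh(1) unfolding E quasi_lincomb[OF adm lc f h ref]
    by (simp add: E algebra_simps)
  with gk show ?thesis by simp
qed

theorem proposition4p10:
  fixes S :: sl_coeffs
    and K l0 :: real
    and u v :: "endpoint \<Rightarrow> real \<Rightarrow> real"
    and u1 u2 :: "complex \<Rightarrow> real \<Rightarrow> complex"
    and A B :: "complex ^ 2 ^ 2"
  assumes "admissible S"
    and "limit_circle S LeftEnd" and "limit_circle S RightEnd"
    and "bounded_below_by S (Lmin S) K"
    and "reference_system S l0 u v"
    and "\<And>l. solution S l (u1 l) \<and> quasi0 S v (u1 l) LeftEnd = 1 \<and> quasi1 S u (u1 l) LeftEnd = 0"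
    and "\<And>l. solution S l (u2 l) \<and> quasi0 S v (u2 l) LeftEnd = 0 \<and> quasi1 S u (u2 l) LeftEnd = 1"
    and "hermitian A" and "hermitian B"
    and "B $ 1 $ 1 \<noteq> 0" and "B $ 1 $ 2 \<noteq> 0" and "B $ 2 $ 2 \<noteq> 0"
  shows "(\<forall>l \<in> resolvent_set S (L_infinity S u). \<forall>t::real.
            eigenvalue S (L_ext S u v (A + t *\<^sub>R B)) l \<and>
            ev_multiplicity S (L_ext S u v (A + t *\<^sub>R B)) l = 2 \<longrightarrow>
            (let u10 = quasi0 S v (u1 l) RightEnd;
                 u11 = quasi1 S u (u1 l) RightEnd;
                 u21 = quasi1 S u (u2 l) RightEnd
             in complex_of_real t = (- (A $ 1 $ 1) * u11 + u21) / (B $ 1 $ 1 * u11) \<and>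
                complex_of_real t = (- (A $ 1 $ 2) * u11 + 1) / (B $ 1 $ 2 * u11) \<and>
                complex_of_real t = (- (A $ 2 $ 1) * u11 + 1) / (B $ 2 $ 1 * u11) \<and>
                complex_of_real t = (- (A $ 2 $ 2) * u11 + u10) / (B $ 2 $ 2 * u11))) \<and>
         (\<forall>l \<in> resolvent_set S (L_infinity S u).
            \<exists>\<^sub>\<le>\<^sub>1 t::real. eigenvalue S (L_ext S u v (A + t *\<^sub>R B)) l \<and>
                     ev_multiplicity S (L_ext S u v (A + t *\<^sub>R B)) l = 2)"
proof -
  have lc: "limit_circle S e" for e using assms(2,3) by (cases e) auto
  obtain x where x: "x \<in> ivl S"
    using einterval_nonempty assms(1) by (auto simp: ivl_def admissible_def)
  \<comment> \<open>Being Hermitian, \<open>B\<close> has conjugate off-diagonal entries.\<close>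
  have B21: "B $ 2 $ 1 \<noteq> 0"
    using assms(9,11) unfolding hermitian_def by (metis complex_cnj_zero)
  have div: "complex_of_real t = (- a * c + d) / (b * c)"
    if "(a + complex_of_real t * b) * c = d" "b \<noteq> 0" "c \<noteq> 0" for t a b c d
    using that by (simp add: eq_divide_eq algebra_simps flip: that(1))
  have main: "complex_of_real t = (- (A $ 1 $ 1) * u11 + u21) / (B $ 1 $ 1 * u11) \<and>
                complex_of_real t = (- (A $ 1 $ 2) * u11 + 1) / (B $ 1 $ 2 * u11) \<and>
                complex_of_real t = (- (A $ 2 $ 1) * u11 + 1) / (B $ 2 $ 1 * u11) \<and>
                complex_of_real t = (- (A $ 2 $ 2) * u11 + u10) / (B $ 2 $ 2 * u11)"
    if l: "l \<in> resolvent_set S (L_infinity S u)"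
      and mult: "ev_multiplicity S (L_ext S u v (A + t *\<^sub>R B)) l = 2"
      and u_def: "u10 = quasi0 S v (u1 l) RightEnd" "u11 = quasi1 S u (u1 l) RightEnd"
        "u21 = quasi1 S u (u2 l) RightEnd" for l t u10 u11 u21
  proof -
    define T where "T = A + t *\<^sub>R B"
    define u20 where "u20 = quasi0 S v (u2 l) RightEnd"
    have T: "T $ i $ j = A $ i $ j + complex_of_real t * B $ i $ j" for i j
      unfolding T_def vector_add_component vector_scaleR_component by (simp add: scaleR_conv_of_real)
    have sol: "solution S l (u1 l)" "solution S l (u2 l)" using assms(6,7) by auto
    note in_E = solution_in_eigenspace_L_ext[OF assms(1) lc assms(5) l mult, folded T_def]
    have "u1 l \<in> eigenspace S (L_ext S u v T) l" by (rule in_E[OF sol(1)])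
    \<comment> \<open>The left boundary values \<open>1\<close> and \<open>0\<close> of
      \<open>u1 l\<close> eliminate the first column of \<open>T\<close>.\<close>
    then have 1: "T $ 1 $ 2 * u11 = 1" "T $ 2 $ 2 * u11 = u10"
      unfolding mem_eigenspace_L_ext[OF assms(1) lc] using assms(6) by (simp_all add: u_def)
    have "u2 l \<in> eigenspace S (L_ext S u v T) l" by (rule in_E[OF sol(2)])
    then have 2: "T $ 1 $ 1 = T $ 1 $ 2 * u21" "T $ 2 $ 1 = T $ 2 $ 2 * u21 - u20"
      unfolding mem_eigenspace_L_ext[OF assms(1) lc] using assms(7)
      by (auto simp: u_def u20_def algebra_simps)
    \<comment> \<open>The same Wronskian at \<open>x\<close> is expressed by the boundary values at
      either end; those at the left give \<open>1\<close>.\<close>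
    have "u10 * u21 - u11 * u20 = 1"
      using wronskian_eq_quasi[OF assms(1) lc sol assms(5) x, of LeftEnd]
        wronskian_eq_quasi[OF assms(1) lc sol assms(5) x, of RightEnd] assms(6,7)
      by (simp add: u_def u20_def)
    moreover have "T $ 2 $ 1 * u11 = T $ 2 $ 2 * u11 * u21 - u11 * u20"
      unfolding 2(2) by (simp add: algebra_simps)
    ultimately have T21: "T $ 2 $ 1 * u11 = 1" by (simp add: 1(2))
    have "T $ 1 $ 1 * u11 = T $ 1 $ 2 * u11 * u21" unfolding 2(1) by (simp add: algebra_simps)
    then have T11: "T $ 1 $ 1 * u11 = u21" by (simp add: 1(1))
    \<comment> \<open>Nonvanishing is read off from \<open>T $ 1 $ 2 * u11 = 1\<close>.\<close>
    have "u11 \<noteq> 0" using 1(1) by auto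
    then show ?thesis
      using 1 T11 T21 assms(10-12) B21 unfolding T by (intro conjI div)
  qed
  show ?thesis
  proof (intro conjI ballI allI impI)
    show "\<exists>\<^sub>\<le>\<^sub>1 t::real. eigenvalue S (L_ext S u v (A + t *\<^sub>R B)) l \<and>
        ev_multiplicity S (L_ext S u v (A + t *\<^sub>R B)) l = 2"
      if "l \<in> resolvent_set S (L_infinity S u)" for l
    proof (rule Uniq_I)
      fix s t
      assume "eigenvalue S (L_ext S u v (A + s *\<^sub>R B)) l \<and> ev_multiplicity S (L_ext S u v (A + s *\<^sub>R B)) l = 2"
        and "eigenvalue S (L_ext S u v (A + t *\<^sub>R B)) l \<and> ev_multiplicity S (L_ext S u v (A + t *\<^sub>R B)) l = 2"
      \<comment> \<open>The formula in \<open>main\<close> has a right-hand side independent of the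
        parameter, so it pins down both values.\<close>
      then have "complex_of_real s = complex_of_real t"
        using main[OF that _ refl refl refl, of s] main[OF that _ refl refl refl, of t] by simp
      then show "s = t" by simp
    qed
  qed (unfold Let_def, rule main[OF _ _ refl refl refl], simp_all)
qed

end
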